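(* Let $g$ be a patchy vector field on an open domain $\Omega\subset\mathbb{R}^n$ and let $T>0$. Let $(w_\nu)_{\nu\ge 1}$ be a sequence of left continuous functions $w_\nu:[0,T]\to\mathbb{R}^n$ of bounded variation with $\mathrm{Tot.Var.}\{w_\nu\}\to 0$ as $\nu\to\infty$, and for each $\nu$ let $y_\nu:[0,T]\to\Omega$ be a solution of the perturbed system $$\dot y_\nu = g(y_\nu)+\dot w_\nu,\qquad t\in[0,T].$$ If the functions $y_\nu$ converge to a function $y:[0,T]\to\Omega$ uniformly on $[0,T]$, then $y$ is a Carathéodory solution of $\dot y=g(y)$ on $[0,T]$.
   Context: **Patch.** A patch is a pair $(\Omega,g)$ where $\Omega\subset\mathbb{R}^n$ is an open domain with smooth boundary $\partial\Omega$, and $g$ is a smooth vector field defined on a neighborhood of the closure $\overline\Omega$, which points strictly inward at each boundary point: $\langle g(x),\mathbf{n}(x)\rangle<0$ for all $x\in\partial\Omega$, where $\mathbf{n}(x)$ is the outer normal at $x$. **Patchy vector field.** A map $g:\Omega\to\mathbb{R}^n$ on an open domain $\Omega\subset\mathbb{R}^n$ is a patchy vector field if there is a family of patches $\{(\Omega_\alpha,g_\alpha):\alpha\in\mathcal{A}\}$ such that: (i) $\mathcal{A}$ is a totally ordered index set; (ii) the open sets $\Omega_\alpha$ form a locally finite covering of $\Omega$, i.e. $\Omega=\bigcup_{\alpha\in\mathcal{A}}\Omega_\alpha$ and every compact set $K\subset\mathbb{R}^n$ intersects only finitely many of the $\Omega_\alpha$; (iii) $g(x)=g_\alpha(x)$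 whenever $x\in\Omega_\alpha\setminus\bigcup_{\beta>\alpha}\Omega_\beta$. **Perturbed system.** For a left continuous function $w$ of bounded variation on $[0,T]$, a solution of $\dot y=g(y)+\dot w$ on $[0,T]$ is a measurable function $y:[0,T]\to\Omega$ such that $y(t)=y(0)+\int_0^t g(y(s))\,ds+[w(t)-w(0)]$ for all $t\in[0,T]$ (so $y$ may be discontinuous). $\mathrm{Tot.Var.}\{w\}$ denotes the total variation of $w$ over the whole interval $[0,T]$. **Carathéodory solution.** An absolutely continuous function $y:[0,T]\to\Omega$ satisfying $\dot y(t)=g(y(t))$ for a.e. $t$, equivalently $y(t)=y(0)+\int_0^t g(y(s))\,ds$ for all $t\in[0,T]$. *)

theory Defs
  imports "HOL-Analysis.Analysis"
begin

text \<open>Only meaningful on open sets \<open>S\<close>: all partial derivatives up to order \<open>k\<close>, expressed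
  through iterated directional derivatives, exist and are continuous on \<open>S\<close>.\<close>

fun Ck_on :: "nat \<Rightarrow> 'a::real_normed_vector set \<Rightarrow> ('a \<Rightarrow> 'b::real_normed_vector) \<Rightarrow> bool" where
  "Ck_on 0 S f \<longleftrightarrow> continuous_on S f"
| "Ck_on (Suc k) S f \<longleftrightarrow>
     (\<forall>x\<in>S. f differentiable (at x)) \<and>
     (\<forall>v. Ck_on k S (\<lambda>x. frechet_derivative f (at x) v))"

definition smooth_on :: "'a::real_normed_vector set \<Rightarrow> ('a \<Rightarrow> 'b::real_normed_vector) \<Rightarrow> bool" where
  "smooth_on S f \<longleftrightarrow> (\<forall>k. Ck_on k S f)"

text \<open>\<open>\<Omega>\<close> lies locally on one side of its boundary, which is a regular level set of \<open>\<phi>\<close>;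
  the gradient of \<open>\<phi>\<close> points out of \<open>\<Omega>\<close>.\<close>

definition local_defining_function ::
  "'a::euclidean_space set \<Rightarrow> 'a \<Rightarrow> 'a set \<Rightarrow> ('a \<Rightarrow> real) \<Rightarrow> bool" where
  "local_defining_function \<Omega> x U \<phi> \<longleftrightarrow>
     open U \<and> x \<in> U \<and> smooth_on U \<phi> \<and>
     (\<forall>z\<in>U. \<exists>D. GDERIV \<phi> z :> D \<and> D \<noteq> 0) \<and>
     \<Omega> \<inter> U = {z \<in> U. \<phi> z < 0} \<and>
     frontier \<Omega> \<inter> U = {z \<in> U. \<phi> z = 0}"

definition smooth_boundary :: "'a::euclidean_space set \<Rightarrow> bool" where
  "smooth_boundary \<Omega> \<longleftrightarrow> (\<forall>x\<in>frontier \<Omega>. \<exists>U \<phi>. local_defining_function \<Omega> x U \<phi>)"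

text \<open>The outer unit normal; it does not depend on the choice of the defining function,
  see \<open>outer_normal_eq\<close> below.\<close>

definition outer_normal :: "'a::euclidean_space set \<Rightarrow> 'a \<Rightarrow> 'a" where
  "outer_normal \<Omega> x =
     (THE \<nu>. \<exists>U \<phi> D. local_defining_function \<Omega> x U \<phi> \<and> GDERIV \<phi> x :> D \<and> \<nu> = D /\<^sub>R norm D)"

lemma gderiv_line:
  fixes \<phi> :: "'a::euclidean_space \<Rightarrow> real"
  assumes "GDERIV \<phi> x :> D"
  shows "((\<lambda>t. \<phi> (x + t *\<^sub>R v)) has_real_derivative (v \<bullet> D)) (at 0)"
proof -
  have "(\<phi> has_derivative (\<lambda>h. h \<bullet> D)) (at (x + 0 *\<^sub>R v))"
    using assms by (simp add: gderiv_def)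
  moreover have "((\<lambda>t. x + t *\<^sub>R v) has_derivative (\<lambda>t. t *\<^sub>R v)) (at 0)"
    by (auto intro!: derivative_eq_intros)
  ultimately have "((\<lambda>t. \<phi> (x + t *\<^sub>R v)) has_derivative (\<lambda>t. (t *\<^sub>R v) \<bullet> D)) (at 0)"
    by (rule has_derivative_compose[rotated])
  moreover have "(\<lambda>t. (t *\<^sub>R v) \<bullet> D) = (*) (v \<bullet> D)"
    by (rule ext) simp
  ultimately show ?thesis
    by (simp only: has_field_derivative_def)
qed

lemma gderiv_unique:
  fixes \<phi> :: "'a::euclidean_space \<Rightarrow> real"
  assumes "GDERIV \<phi> x :> D" "GDERIV \<phi> x :> E"
  shows "D = E"
proof -
  have "(\<lambda>h. h \<bullet> D) = (\<lambda>h. h \<bullet> E)"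
    using assms unfolding gderiv_def by (rule has_derivative_unique)
  then have "\<forall>h. h \<bullet> D = h \<bullet> E" by (simp add: fun_eq_iff)
  then show ?thesis using vector_eq_ldot[of D E] by (simp add: inner_commute)
qed

lemma local_defining_function_normal_unique:
  assumes ldf: "local_defining_function \<Omega> x U \<phi>" "local_defining_function \<Omega> x V \<psi>"
    and fr: "x \<in> frontier \<Omega>"
    and D: "GDERIV \<phi> x :> D" and E: "GDERIV \<psi> x :> E"
  shows "D /\<^sub>R norm D = E /\<^sub>R norm E"
proof (rule ccontr)
  define d e where "d = D /\<^sub>R norm D" and "e = E /\<^sub>R norm E"
  assume "D /\<^sub>R norm D \<noteq> E /\<^sub>R norm E"
  then have ne: "d \<noteq> e" by (simp add: d_def e_def)
  have inside: "\<And>z. z \<in> U \<Longrightarrow> z \<in> \<Omega> \<longleftrightarrow> \<phi> z < 0" "\<And>z. z \<in> V \<Longrightarrow> z \<in> \<Omega> \<longleftrightarrow> \<psi> z < 0"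
    and boundary: "\<And>z. z \<in> U \<Longrightarrow> z \<in> frontier \<Omega> \<longleftrightarrow> \<phi> z = 0"
      "\<And>z. z \<in> V \<Longrightarrow> z \<in> frontier \<Omega> \<longleftrightarrow> \<psi> z = 0"
    and xUV: "x \<in> U" "x \<in> V"
    using ldf by (simp_all add: local_defining_function_def set_eq_iff) metis+
  have grads: "\<exists>D'. GDERIV \<phi> x :> D' \<and> D' \<noteq> 0" "\<exists>E'. GDERIV \<psi> x :> E' \<and> E' \<noteq> 0"
    using ldf xUV by (simp_all only: local_defining_function_def)
  obtain D' E' where "GDERIV \<phi> x :> D'" "D' \<noteq> 0" "GDERIV \<psi> x :> E'" "E' \<noteq> 0"
    using grads by (elim exE conjE)
  then have nz: "D \<noteq> 0" "E \<noteq> 0"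
    using gderiv_unique[OF D] gderiv_unique[OF E] by auto
  then have n1: "norm d = 1" "norm e = 1" by (auto simp: d_def e_def)
  have "0 < (norm (d - e))\<^sup>2" using ne by simp
  also have "(norm (d - e))\<^sup>2 = 2 - 2 * (d \<bullet> e)"
    using n1 by (simp add: power2_norm_eq_inner inner_diff inner_commute norm_eq_1)
  finally have de: "d \<bullet> e < 1" by simp
  define v where "v = e - d"
  have DE: "v \<bullet> D = norm D * (v \<bullet> d)" "v \<bullet> E = norm E * (v \<bullet> e)"
    using nz by (simp_all add: d_def e_def)
  have "v \<bullet> d < 0" "v \<bullet> e > 0"
    using de n1 by (auto simp: v_def inner_diff inner_commute norm_eq_1)
  then have vD: "v \<bullet> D < 0" and vE: "v \<bullet> E > 0"
    using nz by (simp_all add: DE mult_less_0_iff zero_less_mult_iff)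
  have zero: "\<phi> x = 0" "\<psi> x = 0"
    using boundary(1)[OF xUV(1)] boundary(2)[OF xUV(2)] fr by simp_all
  from DERIV_neg_dec_right[OF gderiv_line[OF D] vD] zero obtain r where
    r: "r > 0" "\<And>h. 0 < h \<Longrightarrow> h < r \<Longrightarrow> \<phi> (x + h *\<^sub>R v) < 0" by auto
  from DERIV_pos_inc_right[OF gderiv_line[OF E] vE] zero obtain s where
    s: "s > 0" "\<And>h. 0 < h \<Longrightarrow> h < s \<Longrightarrow> \<psi> (x + h *\<^sub>R v) > 0" by auto
  have "open (U \<inter> V)" "x \<in> U \<inter> V"
    using ldf by (auto simp: local_defining_function_def)
  moreover have "((\<lambda>t. x + t *\<^sub>R v) \<longlongrightarrow> x) (at_right 0)"
    by (auto intro!: tendsto_eq_intros)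
  ultimately have "eventually (\<lambda>t. x + t *\<^sub>R v \<in> U \<inter> V) (at_right 0)"
    by (rule topological_tendstoD[rotated])
  moreover have "eventually (\<lambda>t. t \<in> {0<..<min r s}) (at_right 0)"
    using r s by (intro eventually_at_right_real) auto
  ultimately have "eventually (\<lambda>t. x + t *\<^sub>R v \<in> U \<inter> V \<and> t \<in> {0<..<min r s}) (at_right 0)"
    by eventually_elim auto
  then obtain t where t: "x + t *\<^sub>R v \<in> U \<inter> V" "t \<in> {0<..<min r s}"
    by (metis (no_types, lifting) eventually_happens trivial_limit_at_right_real)
  then have "\<phi> (x + t *\<^sub>R v) < 0" "\<psi> (x + t *\<^sub>R v) > 0" using r s by auto
  then show False
    using t(1) inside by (metis Int_iff order_less_asym)
qed

lemma outer_normal_eq: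
  assumes "local_defining_function \<Omega> x U \<phi>" "x \<in> frontier \<Omega>" "GDERIV \<phi> x :> D"
  shows "outer_normal \<Omega> x = D /\<^sub>R norm D"
  unfolding outer_normal_def
proof (rule the_equality)
  show "\<exists>U \<phi> D'. local_defining_function \<Omega> x U \<phi> \<and> GDERIV \<phi> x :> D' \<and>
      D /\<^sub>R norm D = D' /\<^sub>R norm D'"
    using assms(1,3) by (intro exI conjI) (assumption, assumption, rule refl)
next
  fix \<nu>
  assume "\<exists>V \<psi> E. local_defining_function \<Omega> x V \<psi> \<and> GDERIV \<psi> x :> E \<and> \<nu> = E /\<^sub>R norm E"
  then obtain V \<psi> E where E: "local_defining_function \<Omega> x V \<psi>" "GDERIV \<psi> x :> E"
      "\<nu> = E /\<^sub>R norm E"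
    by (elim exE conjE)
  show "\<nu> = D /\<^sub>R norm D"
    unfolding E(3) by (rule local_defining_function_normal_unique[OF E(1) assms(1,2) E(2) assms(3)])
qed

definition patch :: "'a::euclidean_space set \<Rightarrow> ('a \<Rightarrow> 'a) \<Rightarrow> bool" where
  "patch \<Omega> g \<longleftrightarrow>
     open \<Omega> \<and> smooth_boundary \<Omega> \<and>
     (\<exists>V. open V \<and> closure \<Omega> \<subseteq> V \<and> smooth_on V g) \<and>
     (\<forall>x\<in>frontier \<Omega>. g x \<bullet> outer_normal \<Omega> x < 0)"

text \<open>\<open>r\<close> is the non-strict total order on the index set \<open>A\<close>. The family of patches is an
  explicit argument because a definition cannot quantify existentially over the type of indices.\<close>

definition patchy_vector_field ::
  "'i set \<Rightarrow> 'i rel \<Rightarrow> ('i \<Rightarrow> 'a::euclidean_space set) \<Rightarrow> ('i \<Rightarrow> 'a \<Rightarrow> 'a) \<Rightarrow>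
     'a set \<Rightarrow> ('a \<Rightarrow> 'a) \<Rightarrow> bool" where
  "patchy_vector_field A r P G \<Omega> g \<longleftrightarrow>
     (\<forall>\<alpha>\<in>A. patch (P \<alpha>) (G \<alpha>)) \<and>
     linear_order_on A r \<and>
     \<Omega> = (\<Union>\<alpha>\<in>A. P \<alpha>) \<and>
     (\<forall>K. compact K \<longrightarrow> finite {\<alpha>\<in>A. P \<alpha> \<inter> K \<noteq> {}}) \<and>
     (\<forall>\<alpha>\<in>A. \<forall>x \<in> P \<alpha> - (\<Union>\<beta>\<in>{\<beta>\<in>A. (\<alpha>, \<beta>) \<in> r \<and> \<alpha> \<noteq> \<beta>}. P \<beta>). g x = G \<alpha> x)"

definition total_variation :: "real \<Rightarrow> real \<Rightarrow> (real \<Rightarrow> 'a::real_normed_vector) \<Rightarrow> ennreal" where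
  "total_variation a b w =
     (SUP (n, t) \<in> {(n::nat, t::nat \<Rightarrow> real). t 0 = a \<and> t n = b \<and> (\<forall>i<n. t i \<le> t (Suc i))}.
        \<Sum>i<n. ennreal (norm (w (t (Suc i)) - w (t i))))"

definition bounded_variation_on :: "real \<Rightarrow> real \<Rightarrow> (real \<Rightarrow> 'a::real_normed_vector) \<Rightarrow> bool" where
  "bounded_variation_on a b w \<longleftrightarrow> total_variation a b w < \<infinity>"

definition left_continuous_on :: "real \<Rightarrow> real \<Rightarrow> (real \<Rightarrow> 'a::topological_space) \<Rightarrow> bool" where
  "left_continuous_on a b w \<longleftrightarrow> (\<forall>t\<in>{a<..b}. continuous (at_left t) w)"

definition perturbed_solution ::
  "('a::euclidean_space \<Rightarrow> 'a) \<Rightarrow> 'a set \<Rightarrow> (real \<Rightarrow> 'a) \<Rightarrow> real \<Rightarrow> (real \<Rightarrow> 'a) \<Rightarrow> bool" where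
  "perturbed_solution g \<Omega> w T y \<longleftrightarrow>
     y \<in> {0..T} \<rightarrow> \<Omega> \<and>
     y \<in> borel_measurable (lebesgue_on {0..T}) \<and>
     set_integrable lebesgue {0..T} (\<lambda>s. g (y s)) \<and>
     (\<forall>t\<in>{0..T}. y t = y 0 + (LINT s:{0..t}|lebesgue. g (y s)) + (w t - w 0))"

definition absolutely_continuous_on ::
  "real \<Rightarrow> real \<Rightarrow> (real \<Rightarrow> 'a::real_normed_vector) \<Rightarrow> bool" where
  "absolutely_continuous_on a b f \<longleftrightarrow>
     (\<forall>\<epsilon>>0. \<exists>\<delta>>0. \<forall>(n::nat) (l::nat \<Rightarrow> real) (u::nat \<Rightarrow> real).
        (\<forall>i<n. a \<le> l i \<and> l i \<le> u i \<and> u i \<le> b) \<and>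
        disjoint_family_on (\<lambda>i. {l i<..<u i}) {..<n} \<and>
        (\<Sum>i<n. u i - l i) < \<delta> \<longrightarrow>
        (\<Sum>i<n. norm (f (u i) - f (l i))) < \<epsilon>)"

definition caratheodory_solution ::
  "('a::euclidean_space \<Rightarrow> 'a) \<Rightarrow> 'a set \<Rightarrow> real \<Rightarrow> (real \<Rightarrow> 'a) \<Rightarrow> bool" where
  "caratheodory_solution g \<Omega> T y \<longleftrightarrow>
     y \<in> {0..T} \<rightarrow> \<Omega> \<and>
     absolutely_continuous_on 0 T y \<and>
     (AE t in lebesgue_on {0..T}. (y has_vector_derivative g (y t)) (at t within {0..T}))"

end

theory Submission
  imports Defs
begin

text \<open>The limit \<open>y\<close> stays in a ball met by finitely many patches, where \<open>g\<close> is bounded by some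
  \<open>M\<close>, so \<open>y\<close> is \<open>M\<close>-Lipschitz. Let \<open>\<alpha>\<close> be the top index among the patches not yet excluded.
  Since \<open>G \<alpha>\<close> points strictly inward, \<open>y\<close> cannot leave \<open>P \<alpha>\<close> once it has entered, so a short
  interval splits at one entrance time. After it, \<open>y' = G \<alpha> y\<close>. Before it, \<open>y\<close> avoids \<open>P \<alpha>\<close>,
  but the approximations may still visit \<open>P \<alpha>\<close>: inside they drift inward at a definite speed and
  can only come back out through the perturbation, so by a Vitali covering argument the time they
  spend there is at most a constant times the total variation, and tends to zero. Thus \<open>P \<alpha>\<close> can
  be discarded and one proceeds by induction on the set of remaining patches.\<close>

text \<open>The obstacle is that \<open>g\<close> is discontinuous, so uniform convergence of
  \<open>ys\<close> says nothing about \<open>g (ys)\<close>. The limit may run along the boundary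
  of an open patch, outside it, while the approximations are inside and driven by a different field.
  Since all fields are bounded by \<open>M\<close>, it suffices that the times at which an
  approximation sees the wrong field form sets of measure tending to zero. The induction therefore
  carries two facts about every discarded patch, bundled in \<open>avoids\<close>: the limit is
  absent from it, and the time that the approximations spend in it vanishes. The second fact is what
  lets the next patch be treated as the top one. Strict inwardness is exploited through a local
  defining function \<phi>, which sinks at a rate \<kappa> along motion inside the patch, with room
  to spare for the variation of the field and the nonlinearity of \<phi>. As the approximations may
  jump, \<phi> along them need not be differentiable; every estimate compares \<phi> at two times,
  with errors that are increments of monotone functions of time. This is the form that the covering
  argument accepts.\<close>

section \<open>Covering estimates for increments of monotone functions\<close>

text \<open>Monotonicity makes the image intervals \<open>{W (l i)<..<W (u i)}\<close> pairwise
  disjoint inside \<open>{W a..W b}\<close>, so comparing Lebesgue measures gives the bound without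
  sorting the intervals.\<close>

lemma sum_increments_le:
  fixes W :: "real \<Rightarrow> real" and l u :: "'i \<Rightarrow> real"
  assumes mono: "mono_on {a..b} W"
    and "finite C"
    and lu: "\<And>i. i \<in> C \<Longrightarrow> a \<le> l i \<and> l i < u i \<and> u i \<le> b"
    and disj: "disjoint_family_on (\<lambda>i. {l i<..<u i}) C"
    and "a \<le> b"
  shows "(\<Sum>i\<in>C. W (u i) - W (l i)) \<le> W b - W a"
proof -
  have le: "W s \<le> W t" if "a \<le> s" "s \<le> t" "t \<le> b" for s t
    using mono that by (auto simp: mono_on_def)
  have disj': "{W (l i)<..<W (u i)} \<inter> {W (l j)<..<W (u j)} = {}" if "i \<in> C" "j \<in> C" "i \<noteq> j" for i j
  proof -
    have "{l i<..<u i} \<inter> {l j<..<u j} = {}"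
      using disj that by (auto simp: disjoint_family_on_def)
    moreover have "max (l i) (l j) < min (u i) (u j) \<Longrightarrow>
        (max (l i) (l j) + min (u i) (u j)) / 2 \<in> {l i<..<u i} \<inter> {l j<..<u j}"
      by (auto simp: max_def min_def)
    ultimately have "u i \<le> l j \<or> u j \<le> l i"
      using lu[OF that(1)] lu[OF that(2)] by (smt (verit) empty_iff)
    then show ?thesis
      using le[of "u i" "l j"] le[of "u j" "l i"] lu[OF that(1)] lu[OF that(2)] by force
  qed
  have "(\<Sum>i\<in>C. W (u i) - W (l i)) = (\<Sum>i\<in>C. measure lebesgue {W (l i)<..<W (u i)})"
    using lu le by (intro sum.cong refl) (force simp: measure_def)
  also have "\<dots> = measure lebesgue (\<Union>i\<in>C. {W (l i)<..<W (u i)})"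
  proof (rule measure_finite_Union[symmetric])
    show "emeasure lebesgue {W (l i)<..<W (u i)} \<noteq> \<infinity>" for i
      using emeasure_bounded_finite[of "{W (l i)<..<W (u i)}"] by simp
  qed (use \<open>finite C\<close> disj' in \<open>auto simp: disjoint_family_on_def\<close>)
  also have "\<dots> \<le> measure lebesgue {W a..W b}"
  proof (rule measure_mono_fmeasurable)
    show "(\<Union>i\<in>C. {W (l i)<..<W (u i)}) \<subseteq> {W a..W b}"
    proof
      fix v assume "v \<in> (\<Union>i\<in>C. {W (l i)<..<W (u i)})"
      then obtain i where "i \<in> C" "W (l i) < v" "v < W (u i)" by auto
      then show "v \<in> {W a..W b}"
        using lu[of i] le[of a "l i"] le[of "u i" b] by auto
    qed
  qed (use \<open>finite C\<close> in auto)
  also have "\<dots> = W b - W a"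
    using le[of a b] \<open>a \<le> b\<close> by simp
  finally show ?thesis .
qed

text \<open>By Vitali's lemma, finitely many disjoint intervals of the given kind cover
  a fifth of any compact part of \<open>S\<close>.\<close>

lemma measure_le_of_increments:
  fixes W :: "real \<Rightarrow> real"
  assumes mono: "mono_on {a..b} W" and "a \<le> b"
    and S: "S \<in> sets lebesgue" "S \<subseteq> {a..b}"
    and cov: "\<And>r. r \<in> S \<Longrightarrow> a < r \<Longrightarrow> r < b \<Longrightarrow>
      \<exists>s t. a \<le> s \<and> s < r \<and> r < t \<and> t \<le> b \<and> t - s \<le> W t - W s"
  shows "measure lebesgue S \<le> 5 * (W b - W a)"
proof (rule field_le_epsilon)
  fix e :: real assume "e > 0"
  \<comment> \<open>\<open>cov\<close> speaks only of interior points; the two endpoints are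
    negligible.\<close>
  define S' where "S' = S - {a, b}"
  have S': "S' \<in> lmeasurable"
    unfolding S'_def using S
    by (intro fmeasurable.Diff bounded_set_imp_lmeasurable bounded_subset[OF bounded_closed_interval]) auto
  \<comment> \<open>A compact part misses less than \<open>e\<close> of the measure. Its finite
    subcover makes the Vitali subfamily finite, as \<open>sum_increments_le\<close>
    requires.\<close>
  obtain K where K: "closed K" "K \<subseteq> S'" "S' - K \<in> lmeasurable" "emeasure lebesgue (S' - K) < ennreal e"
    using sets_lebesgue_inner_closed[OF fmeasurableD[OF S'] \<open>e > 0\<close>] by blast
  have "K \<subseteq> {a..b}" using K(2) S by (auto simp: S'_def)
  then have "compact K"
    using K(1) by (meson bounded_closed_interval bounded_subset compact_eq_bounded_closed)
  have "\<forall>r\<in>K. \<exists>p. a \<le> fst p \<and> fst p < r \<and> r < snd p \<and> snd p \<le> b \<and> snd p - fst p \<le> W (snd p) - W (fst p)"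
  proof
    fix r assume "r \<in> K"
    then have "r \<in> S" "a < r" "r < b" using K(2) S by (auto simp: S'_def less_le)
    from cov[OF this] show "\<exists>p. a \<le> fst p \<and> fst p < r \<and> r < snd p \<and> snd p \<le> b \<and> snd p - fst p \<le> W (snd p) - W (fst p)"
      by auto
  qed
  then obtain p where p: "\<And>r. r \<in> K \<Longrightarrow> a \<le> fst (p r) \<and> fst (p r) < r \<and> r < snd (p r) \<and>
      snd (p r) \<le> b \<and> snd (p r) - fst (p r) \<le> W (snd (p r)) - W (fst (p r))"
    by metis
  define l u where "l = (\<lambda>r. fst (p r))" and "u = (\<lambda>r. snd (p r))"
  have lu: "a \<le> l r" "l r < r" "r < u r" "u r \<le> b" "u r - l r \<le> W (u r) - W (l r)" if "r \<in> K" for r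
    using p[OF that] by (auto simp: l_def u_def)
  have K_cov: "K \<subseteq> (\<Union>r\<in>K. {l r<..<u r})" using lu by force
  obtain F where F: "F \<subseteq> K" "finite F" "K \<subseteq> (\<Union>r\<in>F. {l r<..<u r})"
    by (rule compactE_image[OF \<open>compact K\<close> _ K_cov]) auto
  define m h where "m = (\<lambda>r. (l r + u r) / 2)" and "h = (\<lambda>r. (u r - l r) / 2)"
  have ball: "ball (m r) (c * h r) = {m r - c * h r<..<m r + c * h r}" for r c
    by (auto simp: ball_def dist_real_def)
  have ball1: "ball (m r) (h r) = {l r<..<u r}" for r
    using ball[of r 1] by (simp add: m_def h_def field_simps)
  have h: "0 < h r \<and> h r \<le> b - a" if "r \<in> F" for r
    using lu(1)[of r] lu(2)[of r] lu(3)[of r] lu(4)[of r] F(1) that by (auto simp: h_def)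
  have "K \<subseteq> (\<Union>r\<in>F. ball (m r) (h r))" using F(3) by (simp add: ball1)
  then obtain C where C: "countable C" "C \<subseteq> F"
      "pairwise (\<lambda>i j. disjnt (ball (m i) (h i)) (ball (m j) (h j))) C"
      "K \<subseteq> (\<Union>i\<in>C. ball (m i) (5 * h i))"
    using Vitali_covering_lemma_balls[where S = K and K = F and a = m and r = h and B = "b - a"] h by blast
  have "finite C" using C(2) F(2) finite_subset by blast
  have "measure lebesgue K \<le> measure lebesgue (\<Union>i\<in>C. ball (m i) (5 * h i))"
    using C(4) \<open>finite C\<close> \<open>compact K\<close>
    by (intro measure_mono_fmeasurable) (auto intro: lmeasurable_compact fmeasurableD)
  also have "\<dots> \<le> (\<Sum>i\<in>C. measure lebesgue (ball (m i) (5 * h i)))"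
    using \<open>finite C\<close> by (intro measure_UNION_le) auto
  also have "\<dots> = (\<Sum>i\<in>C. 5 * (u i - l i))"
  proof (rule sum.cong[OF refl])
    fix i assume "i \<in> C"
    then have "h i > 0" using h C(2) by auto
    then have "measure lebesgue (ball (m i) (5 * h i)) = 10 * h i"
      unfolding ball by (simp add: measure_def)
    then show "measure lebesgue (ball (m i) (5 * h i)) = 5 * (u i - l i)"
      by (simp add: h_def)
  qed
  also have "\<dots> \<le> (\<Sum>i\<in>C. 5 * (W (u i) - W (l i)))"
  proof (rule sum_mono)
    fix i assume "i \<in> C"
    then have "i \<in> K" using C(2) F(1) by blast
    from lu(5)[OF this] show "5 * (u i - l i) \<le> 5 * (W (u i) - W (l i))" by simp
  qed
  also have "\<dots> \<le> 5 * (W b - W a)"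
  proof -
    have "(\<Sum>i\<in>C. W (u i) - W (l i)) \<le> W b - W a"
    proof (rule sum_increments_le[OF mono \<open>finite C\<close>])
      show "disjoint_family_on (\<lambda>i. {l i<..<u i}) C"
        using C(3) unfolding ball1 by (auto simp: disjoint_family_on_def pairwise_def disjnt_def)
      show "a \<le> l i \<and> l i < u i \<and> u i \<le> b" if "i \<in> C" for i
      proof -
        have "i \<in> K" using that C(2) F(1) by blast
        from lu[OF this] show ?thesis by simp
      qed
    qed fact
    then show ?thesis unfolding sum_distrib_left[symmetric] by simp
  qed
  finally have K_le: "measure lebesgue K \<le> 5 * (W b - W a)" .
  have "measure lebesgue S = measure lebesgue S'"
  proof (rule measure_negligible_symdiff[symmetric])
    show "negligible (S - S' \<union> (S' - S))"
      by (rule negligible_subset[of "{a, b}"]) (auto simp: S'_def)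
    show "S \<in> lmeasurable"
      using S by (intro bounded_set_imp_lmeasurable bounded_subset[OF bounded_closed_interval])
  qed
  also have "\<dots> \<le> measure lebesgue (K \<union> (S' - K))"
    using S' K \<open>compact K\<close> by (intro measure_mono_fmeasurable) (auto intro: lmeasurable_compact fmeasurableD)
  also have "\<dots> \<le> measure lebesgue K + measure lebesgue (S' - K)"
    using K \<open>compact K\<close> by (intro measure_Un_le) (auto intro: lmeasurable_compact fmeasurableD)
  also have "measure lebesgue (S' - K) \<le> e"
    using K(4) \<open>e > 0\<close> unfolding measure_def
    by (metis enn2real_leI less_imp_le)
  finally show "measure lebesgue S \<le> 5 * (W b - W a) + e" using K_le by linarith
qed

text \<open>While \<open>h\<close> is negative it sinks at rate \<kappa>, so a return to level zero
  must be paid for by an increment of \<open>W\<close>. Hence each point of \<open>J\<close> lies in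
  an interval whose length is at most the increment of a multiple of \<open>W\<close>, and the
  covering estimate applies. The number \<eta> bounds what is still owed if \<open>h\<close> is
  below zero at the final time.\<close>

lemma measure_below_level_le:
  fixes h W :: "real \<Rightarrow> real"
  assumes "a \<le> b" and mono: "mono_on {a..b} W"
    and J: "J \<in> sets lebesgue" "J \<subseteq> {a..b}" "\<And>r. r \<in> {a..b} \<Longrightarrow> r \<in> J \<longleftrightarrow> h r < 0"
    and "\<kappa> > 0" "C \<ge> 0" "\<eta> \<ge> 0"
    and fin: "h b \<ge> - \<eta>"
    and decr: "\<And>s t. a \<le> s \<Longrightarrow> s \<le> t \<Longrightarrow> t \<le> b \<Longrightarrow> {s..<t} \<subseteq> J \<Longrightarrow>
      h t - h s \<le> - \<kappa> * (t - s) + (W t - W s)"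
    and incr: "\<And>s t. a \<le> s \<Longrightarrow> s \<le> t \<Longrightarrow> t \<le> b \<Longrightarrow> h t - h s \<le> C * (t - s) + (W t - W s)"
  shows "measure lebesgue J \<le> 5 / \<kappa> * (W b - W a + \<eta>)"
proof -
  \<comment> \<open>Dividing by \<kappa> turns cost into time; the extra jump at \<open>b\<close>
    pays the debt \<eta> of a path that never returns to level zero.\<close>
  define V where "V = (\<lambda>t. (W t + (if t = b then \<eta> else 0)) / \<kappa>)"
  have V_mono: "mono_on {a..b} V"
    using mono \<open>\<eta> \<ge> 0\<close> \<open>\<kappa> > 0\<close>
    by (auto simp: mono_on_def V_def divide_right_mono add_increasing2)
  have "measure lebesgue J \<le> 5 * (V b - V a)"
  proof (rule measure_le_of_increments[OF V_mono \<open>a \<le> b\<close> J(1,2)])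
    fix r assume r: "r \<in> J" "a < r" "r < b"
    define X where "X = {t. r \<le> t \<and> t \<le> b \<and> {r..<t} \<subseteq> J}"
    \<comment> \<open>The end of the stay in \<open>J\<close> that starts at \<open>r\<close>. Since
      \<open>h\<close> may jump, \<open>e\<close> itself can lie in \<open>J\<close> or outside
      it.\<close>
    define e where "e = Sup X"
    have X: "r \<in> X" "bdd_above X" using r by (auto simp: X_def)
    have e: "r \<le> e" "e \<le> b"
      using X by (auto simp: e_def X_def intro!: cSup_upper cSup_least)
    have below: "{r..<e} \<subseteq> J"
    proof
      fix u assume "u \<in> {r..<e}"
      then obtain t where "t \<in> X" "u < t"
        using less_cSup_iff[OF _ X(2)] X(1) by (auto simp: e_def)
      then show "u \<in> J" using \<open>u \<in> {r..<e}\<close> by (auto simp: X_def)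
    qed
    have hr: "h r < 0" using J(3)[of r] r by auto
    \<comment> \<open>The negative term \<open>h r / 2\<close> is kept as slack: it will pay for
      extending the interval to the left of \<open>r\<close>, which must be an interior
      point.\<close>
    have "\<exists>t. r < t \<and> t \<le> b \<and> \<kappa> * (t - r) \<le> \<kappa> * (V t - V r) + h r / 2"
    proof (cases "e \<in> J")
      case False
      then have "r < e" using e r by (auto simp: less_le)
      have "h e \<ge> 0" using J(3)[of e] False e r by auto
      moreover have "h e - h r \<le> - \<kappa> * (e - r) + (W e - W r)"
        using decr[of r e] below e r by auto
      moreover have "W e - W r \<le> \<kappa> * (V e - V r)"
        using \<open>\<kappa> > 0\<close> \<open>\<eta> \<ge> 0\<close> r by (simp add: V_def field_simps)
      ultimately show ?thesis
        using \<open>r < e\<close> e hr by (intro exI[of _ e]) (auto simp: algebra_simps)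
    next
      case True
      show ?thesis
      proof (cases "e = b")
        case True
        have "h b - h r \<le> - \<kappa> * (b - r) + (W b - W r)"
          using decr[of r b] below e r True by auto
        moreover have "\<kappa> * (V b - V r) = W b - W r + \<eta>"
          using \<open>\<kappa> > 0\<close> r by (simp add: V_def field_simps)
        ultimately show ?thesis
          using fin hr r by (intro exI[of _ b]) (auto simp: algebra_simps)
      next
        case False
        \<comment> \<open>Here \<open>e\<close> is in \<open>J\<close>, yet points outside
          \<open>J\<close> lie arbitrarily close to its right. Up to such a point only the crude
          rate \<open>C\<close> is available; this \<open>d\<close> keeps the resulting loss
          \<open>(C + \<kappa>) * (t - e)\<close> below half of \<open>- h r\<close>.\<close>
        define d where "d = min (b - e) (- h r / (2 * (C + \<kappa>)))"
        have "- h r / (2 * (C + \<kappa>)) > 0"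
          using hr \<open>C \<ge> 0\<close> \<open>\<kappa> > 0\<close> by (intro divide_pos_pos) auto
        then have "d > 0" unfolding d_def using False e by (simp only: min_less_iff_conj) simp
        have "\<not> {r..<e + d} \<subseteq> J"
        proof
          assume "{r..<e + d} \<subseteq> J"
          then have "e + d \<in> X" using e \<open>d > 0\<close> by (auto simp: X_def d_def)
          then have "e + d \<le> e" unfolding e_def by (rule cSup_upper[OF _ X(2)])
          then show False using \<open>d > 0\<close> by simp
        qed
        then obtain t where t: "r \<le> t" "t < e + d" "t \<notin> J"
          by (auto simp: subset_iff)
        have "e \<le> t" using t below by (meson atLeastLessThan_iff not_le subsetD)
        then have "e < t" using t True by (auto simp: less_le)
        have "t \<le> b" using t by (auto simp: d_def)
        have "h t \<ge> 0" using J(3)[of t] t \<open>t \<le> b\<close> r by auto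
        have 1: "h e - h r \<le> - \<kappa> * (e - r) + (W e - W r)"
          using decr[of r e] below e r by auto
        have 2: "h t - h e \<le> C * (t - e) + (W t - W e)"
          using incr[of e t] e r \<open>e < t\<close> \<open>t \<le> b\<close> by auto
        have 3: "W t - W r \<le> \<kappa> * (V t - V r)"
          using \<open>\<kappa> > 0\<close> \<open>\<eta> \<ge> 0\<close> r by (simp add: V_def field_simps)
        have "(C + \<kappa>) * (t - e) \<le> (C + \<kappa>) * d"
          using t \<open>C \<ge> 0\<close> \<open>\<kappa> > 0\<close> by (intro mult_left_mono) auto
        also have "\<dots> \<le> (C + \<kappa>) * (- h r / (2 * (C + \<kappa>)))"
          using \<open>C \<ge> 0\<close> \<open>\<kappa> > 0\<close> by (intro mult_left_mono) (auto simp: d_def)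
        also have "\<dots> = - h r / 2" using \<open>C \<ge> 0\<close> \<open>\<kappa> > 0\<close> by (simp add: field_simps)
        finally have "(C + \<kappa>) * (t - e) \<le> - h r / 2" .
        with 1 2 3 \<open>h t \<ge> 0\<close> show ?thesis
          using \<open>e < t\<close> e \<open>t \<le> b\<close> by (intro exI[of _ t]) (auto simp: algebra_simps)
      qed
    qed
    then obtain t where t: "r < t" "t \<le> b" "\<kappa> * (t - r) \<le> \<kappa> * (V t - V r) + h r / 2" by blast
    \<comment> \<open>The left extension uses up exactly the slack, unless it is cut off at
      \<open>a\<close>; monotonicity of \<open>V\<close> ensures that it loses nothing on the
      right-hand side.\<close>
    define s where "s = max a (r + h r / (2 * \<kappa>))"
    have s: "a \<le> s" "s < r" using r hr \<open>\<kappa> > 0\<close> by (auto simp: s_def divide_neg_pos)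
    have "r - s \<le> - h r / (2 * \<kappa>)" by (auto simp: s_def)
    then have "\<kappa> * (r - s) \<le> \<kappa> * (- h r / (2 * \<kappa>))"
      using \<open>\<kappa> > 0\<close> by (intro mult_left_mono) auto
    also have "\<dots> = - h r / 2" using \<open>\<kappa> > 0\<close> by simp
    finally have "\<kappa> * (t - s) \<le> \<kappa> * (V t - V r)" using t(3) by (simp add: algebra_simps)
    then have "t - s \<le> V t - V r" using \<open>\<kappa> > 0\<close> by simp
    moreover have "V s \<le> V r" using V_mono s r by (auto simp: mono_on_def)
    ultimately have "t - s \<le> V t - V s" by linarith
    then show "\<exists>s t. a \<le> s \<and> s < r \<and> r < t \<and> t \<le> b \<and> t - s \<le> V t - V s"
      using s t by (intro exI[of _ s] exI[of _ t]) auto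
  qed
  also have "\<dots> \<le> 5 * ((W b - W a + \<eta>) / \<kappa>)"
    using \<open>\<kappa> > 0\<close> \<open>\<eta> \<ge> 0\<close> by (auto simp: V_def field_simps)
  finally show ?thesis by simp
qed

section \<open>Variation functions, strict differentiability and integral bounds\<close>

text \<open>Every partition of \<open>{a..s}\<close> becomes one of \<open>{a..t}\<close> by
  appending the point \<open>t\<close>.\<close>

lemma total_variation_add_increment:
  assumes "a \<le> s" "s \<le> t"
  shows "total_variation a s w + ennreal (norm (w t - w s)) \<le> total_variation a t w"
proof -
  define Q where "Q = (\<lambda>b. {(n::nat, p::nat \<Rightarrow> real). p 0 = a \<and> p n = b \<and> (\<forall>i<n. p i \<le> p (Suc i))})"
  define S where "S = (\<lambda>(n, p). \<Sum>i<n. ennreal (norm (w (p (Suc i)) - w (p i))))"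
  have tv: "total_variation a b w = (SUP np \<in> Q b. S np)" for b
    by (simp add: total_variation_def Q_def S_def)
  have "(Suc 0, \<lambda>i. if i = 0 then a else s) \<in> Q s" using assms by (auto simp: Q_def)
  then have "Q s \<noteq> {}" by blast
  then have "total_variation a s w + ennreal (norm (w t - w s)) =
      (SUP np \<in> Q s. S np + ennreal (norm (w t - w s)))"
    by (simp add: tv ennreal_SUP_add_left)
  also have "\<dots> \<le> (SUP np \<in> Q t. S np)"
  proof (rule SUP_least)
    fix np assume "np \<in> Q s"
    then obtain n p where np: "np = (n, p)" "p 0 = a" "p n = s" "\<forall>i<n. p i \<le> p (Suc i)"
      by (auto simp: Q_def)
    have "(Suc n, p(Suc n := t)) \<in> Q t"
      using np assms by (auto simp: Q_def less_Suc_eq)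
    moreover have "S np + ennreal (norm (w t - w s)) = S (Suc n, p(Suc n := t))"
      using np by (auto simp: S_def simp del: sum_ennreal intro!: sum.cong arg_cong2[where f = "(+)"])
    ultimately show "S np + ennreal (norm (w t - w s)) \<le> (SUP np \<in> Q t. S np)"
      by (simp add: SUP_upper)
  qed
  finally show ?thesis by (simp add: tv)
qed

text \<open>Additivity in \<open>ennreal\<close> cannot be rearranged by subtraction, so finiteness
  of both variations is derived first and the inequality is then moved to the reals.\<close>

lemma norm_increment_le_variation:
  assumes "a \<le> s" "s \<le> t" "t \<le> b" and "bounded_variation_on a b w"
  shows "norm (w t - w s) \<le> enn2real (total_variation a t w) - enn2real (total_variation a s w)"
proof -
  have "total_variation a t w + ennreal (norm (w b - w t)) \<le> total_variation a b w"
    using assms by (intro total_variation_add_increment) auto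
  also have "\<dots> < \<infinity>" using assms(4) by (simp add: bounded_variation_on_def)
  finally have t: "total_variation a t w < top" by simp
  have le: "total_variation a s w + ennreal (norm (w t - w s)) \<le> total_variation a t w"
    using assms by (intro total_variation_add_increment) auto
  also note t
  finally have s: "total_variation a s w < top" by simp
  have "enn2real (total_variation a s w + ennreal (norm (w t - w s))) \<le> enn2real (total_variation a t w)"
    using le t by (rule enn2real_mono)
  then show ?thesis using s by (simp add: enn2real_plus)
qed

text \<open>The mean value inequality for \<phi> minus its linear part gives a bound in which both
  points vary, as increments along a discontinuous path require. \<open>smooth_on\<close> supplies
  only continuity of each directional derivative; expanding in the basis yields the operator
  norm.\<close>

lemma smooth_on_strictly_differentiable:
  fixes \<phi> :: "'a::euclidean_space \<Rightarrow> real"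
  assumes "open U" "x \<in> U" "smooth_on U \<phi>" and D: "GDERIV \<phi> x :> D" and "\<eta> > 0"
  obtains \<rho> where "\<rho> > 0" "ball x \<rho> \<subseteq> U"
    "\<And>p q. p \<in> ball x \<rho> \<Longrightarrow> q \<in> ball x \<rho> \<Longrightarrow> \<bar>\<phi> p - \<phi> q - D \<bullet> (p - q)\<bar> \<le> \<eta> * norm (p - q)"
proof -
  define f' where "f' = (\<lambda>z. frechet_derivative \<phi> (at z))"
  have "Ck_on (Suc 0) U \<phi>" using assms(3) by (auto simp: smooth_on_def)
  then have diff: "\<And>z. z \<in> U \<Longrightarrow> (\<phi> has_derivative f' z) (at z)"
    and cont: "\<And>v. continuous_on U (\<lambda>z. f' z v)"
    by (auto simp: f'_def frechet_derivative_works)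
  have f'x: "f' x = (\<lambda>h. h \<bullet> D)"
    using has_derivative_unique[OF diff[OF \<open>x \<in> U\<close>]] D by (auto simp: gderiv_def)
  \<comment> \<open>The operator norm is bounded by a sum over the basis, so each basis direction is
    allotted an equal share of \<eta>.\<close>
  define \<delta> where "\<delta> = \<eta> / real DIM('a)"
  have "\<delta> > 0" using \<open>\<eta> > 0\<close> by (simp add: \<delta>_def)
  have "eventually (\<lambda>z. \<bar>f' z b - f' x b\<bar> < \<delta>) (nhds x)" for b
  proof -
    have "isCont (\<lambda>z. f' z b) x"
      using cont \<open>open U\<close> \<open>x \<in> U\<close> continuous_on_eq_continuous_at by blast
    then have "eventually (\<lambda>z. dist (f' z b) (f' x b) < \<delta>) (at x)"
      unfolding isCont_def using \<open>\<delta> > 0\<close> by (rule tendstoD)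
    then show ?thesis
      using \<open>\<delta> > 0\<close> by (simp add: eventually_nhds_conv_at dist_real_def)
  qed
  then have "eventually (\<lambda>z. \<forall>b\<in>Basis. \<bar>f' z b - f' x b\<bar> < \<delta>) (nhds x)"
    by (intro eventually_ball_finite) auto
  moreover have "eventually (\<lambda>z. z \<in> U) (nhds x)"
    using \<open>open U\<close> \<open>x \<in> U\<close> by (rule eventually_nhds_in_open)
  ultimately have "eventually (\<lambda>z. z \<in> U \<and> (\<forall>b\<in>Basis. \<bar>f' z b - f' x b\<bar> < \<delta>)) (nhds x)"
    by eventually_elim auto
  then obtain \<rho> where "\<rho> > 0" and \<rho>: "\<And>z. z \<in> ball x \<rho> \<Longrightarrow> z \<in> U \<and> (\<forall>b\<in>Basis. \<bar>f' z b - f' x b\<bar> < \<delta>)"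
    by (auto simp: eventually_nhds_metric dist_commute)
  show ?thesis
  proof
    show "\<rho> > 0" "ball x \<rho> \<subseteq> U" using \<open>\<rho> > 0\<close> \<rho> by auto
    fix p q assume pq: "p \<in> ball x \<rho>" "q \<in> ball x \<rho>"
    have "norm ((\<phi> p - p \<bullet> D) - (\<phi> q - q \<bullet> D)) \<le> \<eta> * norm (p - q)"
    proof (rule differentiable_bound[OF convex_ball _ _ pq])
      fix z assume z: "z \<in> ball x \<rho>"
      then have lin: "linear (f' z)" using diff \<rho> has_derivative_linear by blast
      show "((\<lambda>z. \<phi> z - z \<bullet> D) has_derivative (\<lambda>h. f' z h - h \<bullet> D)) (at z within ball x \<rho>)"
        using diff[of z] \<rho>[OF z]
        by (auto intro!: derivative_eq_intros intro: has_derivative_at_withinI)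
      show "onorm (\<lambda>h. f' z h - h \<bullet> D) \<le> \<eta>"
      proof (rule onorm_le)
        fix h :: 'a
        have "f' z h - h \<bullet> D = (\<Sum>b\<in>Basis. (h \<bullet> b) * (f' z b - f' x b))"
        proof -
          have "f' z h = (\<Sum>b\<in>Basis. (h \<bullet> b) * f' z b)"
            by (subst euclidean_representation[of h, symmetric])
               (simp add: linear_sum[OF lin] linear_cmul[OF lin] del: euclidean_representation)
          moreover have "h \<bullet> D = (\<Sum>b\<in>Basis. (h \<bullet> b) * f' x b)"
            by (subst euclidean_inner) (simp add: f'x inner_commute)
          ultimately show ?thesis by (simp add: sum_subtractf right_diff_distrib)
        qed
        also have "norm \<dots> \<le> (\<Sum>b\<in>(Basis::'a set). norm h * \<delta>)"
        proof (rule sum_norm_le)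
          fix b :: 'a assume "b \<in> Basis"
          then show "norm ((h \<bullet> b) * (f' z b - f' x b)) \<le> norm h * \<delta>"
            using \<rho>[OF z] Basis_le_norm[of b h] unfolding real_norm_def abs_mult
            by (intro mult_mono) (auto intro: less_imp_le)
        qed
        also have "\<dots> = \<eta> * norm h" by (simp add: \<delta>_def)
        finally show "norm (f' z h - h \<bullet> D) \<le> \<eta> * norm h" .
      qed
    qed
    then show "\<bar>\<phi> p - \<phi> q - D \<bullet> (p - q)\<bar> \<le> \<eta> * norm (p - q)"
      by (simp add: inner_diff_right inner_commute algebra_simps)
  qed
qed

lemma norm_integral_minus_const_le:
  fixes f :: "real \<Rightarrow> 'a::euclidean_space"
  assumes f: "f integrable_on {s..t}" and "s \<le> t" and E: "E \<in> sets lebesgue"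
    and le: "\<And>r. s < r \<Longrightarrow> r < t \<Longrightarrow> norm (f r - v) \<le> \<epsilon> + C * indicator E r"
  shows "norm (integral {s..t} f - (t - s) *\<^sub>R v) \<le> \<epsilon> * (t - s) + C * measure lebesgue (E \<inter> {s..t})"
proof -
  have "E \<inter> {s..t} \<in> lmeasurable"
    using E by (intro bounded_set_imp_lmeasurable) (auto intro: bounded_subset[of "{s..t}"])
  then have I: "((indicator E :: real \<Rightarrow> real) has_integral measure lebesgue (E \<inter> {s..t})) {s..t}"
    using integral_indicator[of E "{s..t}"] integrable_on_indicator[of E "{s..t}"]
    by (auto simp: has_integral_iff)
  have R: "((\<lambda>r. \<epsilon> + C * indicator E r) has_integral
      (\<epsilon> * (t - s) + C * measure lebesgue (E \<inter> {s..t}))) {s..t}"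
    using has_integral_add[OF has_integral_const_real[of \<epsilon> s t] has_integral_mult_right[OF I, of C]] \<open>s \<le> t\<close>
    by (simp add: mult.commute)
  have L: "((\<lambda>r. f r - v) has_integral (integral {s..t} f - (t - s) *\<^sub>R v)) {s..t}"
    using has_integral_diff[OF integrable_integral[OF f] has_integral_const_real[of v s t]] \<open>s \<le> t\<close> by simp
  have "norm (integral {s..t} f - (t - s) *\<^sub>R v) = norm (integral {s<..<t} (\<lambda>r. f r - v))"
    using L by (metis integral_open_interval_real integral_unique)
  also have "\<dots> \<le> integral {s<..<t} (\<lambda>r. \<epsilon> + C * indicator E r)"
    using L R le
    by (intro integral_norm_bound_integral) (auto simp: integrable_on_open_interval_real)
  also have "\<dots> = \<epsilon> * (t - s) + C * measure lebesgue (E \<inter> {s..t})"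
    using R by (metis integral_open_interval_real integral_unique)
  finally show ?thesis .
qed

subsection \<open>Uniform limits of perturbed solutions\<close>

locale patchy_limit =
  fixes A :: "'i set" and r :: "'i rel"
    and P :: "'i \<Rightarrow> 'a::euclidean_space set" and G :: "'i \<Rightarrow> 'a \<Rightarrow> 'a"
    and \<Omega> :: "'a set" and g :: "'a \<Rightarrow> 'a" and T :: real
    and w ys :: "nat \<Rightarrow> real \<Rightarrow> 'a" and y :: "real \<Rightarrow> 'a"
  assumes patchy: "patchy_vector_field A r P G \<Omega> g"
    and T_pos: "T > 0"
    and bv: "\<And>\<nu>. \<nu> \<ge> 1 \<Longrightarrow> bounded_variation_on 0 T (w \<nu>)"
    and tv_tendsto: "(\<lambda>\<nu>. total_variation 0 T (w \<nu>)) \<longlonglongrightarrow> 0"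
    and sol: "\<And>\<nu>. \<nu> \<ge> 1 \<Longrightarrow> perturbed_solution g \<Omega> (w \<nu>) T (ys \<nu>)"
    and y_in: "y \<in> {0..T} \<rightarrow> \<Omega>"
    and lim: "uniform_limit {0..T} ys y sequentially"
begin

text \<open>On \<open>{0..T}\<close> this is a monotone real function that dominates the increments
  of \<open>w \<nu>\<close> and whose final value tends to zero; the estimates below see the
  perturbation only through it.\<close>

definition V :: "nat \<Rightarrow> real \<Rightarrow> real" where
  "V \<nu> t = enn2real (total_variation 0 t (w \<nu>))"

lemma w_increment:
  "\<nu> \<ge> 1 \<Longrightarrow> 0 \<le> s \<Longrightarrow> s \<le> t \<Longrightarrow> t \<le> T \<Longrightarrow> norm (w \<nu> t - w \<nu> s) \<le> V \<nu> t - V \<nu> s"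
  unfolding V_def using norm_increment_le_variation bv by blast

lemma V_mono: "\<nu> \<ge> 1 \<Longrightarrow> 0 \<le> s \<Longrightarrow> s \<le> t \<Longrightarrow> t \<le> T \<Longrightarrow> V \<nu> s \<le> V \<nu> t"
  using w_increment[of \<nu> s t] norm_ge_zero[of "w \<nu> t - w \<nu> s"] by linarith

lemma V_nonneg: "0 \<le> V \<nu> t"
  by (simp add: V_def)

lemma V_tendsto: "(\<lambda>\<nu>. V \<nu> T) \<longlonglongrightarrow> 0"
  unfolding V_def using tendsto_enn2real[of _ 0] tv_tendsto by simp

lemma ys_in: "\<nu> \<ge> 1 \<Longrightarrow> t \<in> {0..T} \<Longrightarrow> ys \<nu> t \<in> \<Omega>"
  using sol[of \<nu>] unfolding perturbed_solution_def by (blast dest: Pi_mem)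

lemma y_in': "t \<in> {0..T} \<Longrightarrow> y t \<in> \<Omega>"
  using y_in by auto

lemma integrable: "\<nu> \<ge> 1 \<Longrightarrow> 0 \<le> s \<Longrightarrow> t \<le> T \<Longrightarrow> (\<lambda>u. g (ys \<nu> u)) integrable_on {s..t}"
proof -
  assume "\<nu> \<ge> 1" "0 \<le> s" "t \<le> T"
  then have "(\<lambda>u. g (ys \<nu> u)) integrable_on {0..T}"
    using sol[of \<nu>] unfolding perturbed_solution_def
    by (blast intro: set_lebesgue_integral_eq_integral(1))
  then show ?thesis
    by (rule integrable_subinterval_real) (use \<open>0 \<le> s\<close> \<open>t \<le> T\<close> in auto)
qed

lemma ys_eq:
  assumes "\<nu> \<ge> 1" "t \<in> {0..T}"
  shows "ys \<nu> t = ys \<nu> 0 + integral {0..t} (\<lambda>u. g (ys \<nu> u)) + (w \<nu> t - w \<nu> 0)"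
proof -
  have "set_integrable lebesgue {0..T} (\<lambda>s. g (ys \<nu> s))"
    using sol[OF assms(1)] by (simp add: perturbed_solution_def)
  then have "set_integrable lebesgue {0..t} (\<lambda>s. g (ys \<nu> s))"
    by (rule set_integrable_subset) (use assms in auto)
  then have "(LINT s:{0..t}|lebesgue. g (ys \<nu> s)) = integral {0..t} (\<lambda>u. g (ys \<nu> u))"
    by (rule set_lebesgue_integral_eq_integral(2))
  moreover have "ys \<nu> t = ys \<nu> 0 + (LINT s:{0..t}|lebesgue. g (ys \<nu> s)) + (w \<nu> t - w \<nu> 0)"
    using sol[OF assms(1)] assms(2) unfolding perturbed_solution_def by blast
  ultimately show ?thesis by (simp only:)
qed

lemma ys_increment:
  assumes "\<nu> \<ge> 1" "0 \<le> s" "s \<le> t" "t \<le> T"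
  shows "ys \<nu> t - ys \<nu> s = integral {s..t} (\<lambda>u. g (ys \<nu> u)) + (w \<nu> t - w \<nu> s)"
proof -
  have sum: "integral {0..s} (\<lambda>u. g (ys \<nu> u)) + integral {s..t} (\<lambda>u. g (ys \<nu> u)) =
      integral {0..t} (\<lambda>u. g (ys \<nu> u))"
    using assms by (intro Henstock_Kurzweil_Integration.integral_combine integrable) auto
  have eqs: "ys \<nu> s = ys \<nu> 0 + integral {0..s} (\<lambda>u. g (ys \<nu> u)) + (w \<nu> s - w \<nu> 0)"
    "ys \<nu> t = ys \<nu> 0 + integral {0..t} (\<lambda>u. g (ys \<nu> u)) + (w \<nu> t - w \<nu> 0)"
    using assms by (auto intro!: ys_eq)
  show ?thesis unfolding eqs sum[symmetric] by (simp add: algebra_simps)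
qed

lemma eventually_close:
  "e > 0 \<Longrightarrow> eventually (\<lambda>\<nu>. \<forall>t\<in>{0..T}. dist (ys \<nu> t) (y t) < e) sequentially"
  using lim by (rule uniform_limitD)

lemma ys_tendsto: "t \<in> {0..T} \<Longrightarrow> (\<lambda>\<nu>. ys \<nu> t) \<longlonglongrightarrow> y t"
  using lim by (rule tendsto_uniform_limitI)

text \<open>A bound on \<open>g\<close> is not yet available, since it presupposes a bounded region.
  Instead the integrability contained in the notion of solution makes the integral term continuous,
  hence bounded on \<open>{0..T}\<close>.\<close>

lemma bounded_solution:
  assumes "\<nu> \<ge> 1"
  shows "bounded (ys \<nu> ` {0..T})"
proof -
  have "compact ((\<lambda>t. integral {0..t} (\<lambda>u. g (ys \<nu> u))) ` {0..T})"
    using assms by (intro compact_continuous_image indefinite_integral_continuous_1 integrable) auto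
  then obtain B where B: "\<And>t. t \<in> {0..T} \<Longrightarrow> norm (integral {0..t} (\<lambda>u. g (ys \<nu> u))) \<le> B"
    using compact_imp_bounded[THEN bounded_iff[THEN iffD1]] by (metis imageI)
  have "norm (ys \<nu> t) \<le> norm (ys \<nu> 0) + B + V \<nu> T" if t: "t \<in> {0..T}" for t
  proof -
    have "norm (ys \<nu> t) \<le> norm (ys \<nu> 0) + norm (integral {0..t} (\<lambda>u. g (ys \<nu> u))) + norm (w \<nu> t - w \<nu> 0)"
      by (subst ys_eq[OF assms t]) (rule norm_triangle_le, simp add: norm_triangle_ineq)
    moreover have "norm (w \<nu> t - w \<nu> 0) \<le> V \<nu> T"
      using w_increment[of \<nu> 0 t] V_mono[of \<nu> t T] V_nonneg[of \<nu> 0] assms t by force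
    ultimately show ?thesis using B[OF t] by linarith
  qed
  then show ?thesis unfolding bounded_iff by blast
qed

text \<open>A single approximation within distance 1 of \<open>y\<close>, bounded by
  \<open>B\<close>, bounds \<open>y\<close> by \<open>B + 1\<close>; then all approximations within
  distance 1 of \<open>y\<close> are bounded by \<open>B + 2\<close>.\<close>

lemma ex_radius:
  obtains R where "\<And>t. t \<in> {0..T} \<Longrightarrow> norm (y t) \<le> R"
    "eventually (\<lambda>\<nu>. \<forall>t\<in>{0..T}. norm (ys \<nu> t) \<le> R) sequentially"
proof -
  have "eventually (\<lambda>\<nu>. \<nu> \<ge> 1 \<and> (\<forall>t\<in>{0..T}. dist (ys \<nu> t) (y t) < 1)) sequentially"
    using eventually_conj[OF eventually_ge_at_top[of "1::nat"] eventually_close[of 1]] by simp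
  then obtain \<nu> where \<nu>: "\<nu> \<ge> 1" "\<And>t. t \<in> {0..T} \<Longrightarrow> dist (ys \<nu> t) (y t) < 1"
    by (auto simp: eventually_sequentially)
  obtain B where B: "\<And>t. t \<in> {0..T} \<Longrightarrow> norm (ys \<nu> t) \<le> B"
    using bounded_solution[OF \<nu>(1)] unfolding bounded_iff by blast
  have y: "norm (y t) \<le> B + 1" if "t \<in> {0..T}" for t
    using B[OF that] \<nu>(2)[OF that] norm_triangle_sub[of "y t" "ys \<nu> t"]
    by (simp add: dist_norm norm_minus_commute)
  show ?thesis
  proof
    show "norm (y t) \<le> B + 2" if "t \<in> {0..T}" for t using y[OF that] by simp
    show "eventually (\<lambda>\<nu>. \<forall>t\<in>{0..T}. norm (ys \<nu> t) \<le> B + 2) sequentially"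
    proof (rule eventually_mono[OF eventually_close[of 1]])
      fix \<nu>' assume *: "\<forall>t\<in>{0..T}. dist (ys \<nu>' t) (y t) < 1"
      show "\<forall>t\<in>{0..T}. norm (ys \<nu>' t) \<le> B + 2"
      proof
        fix t assume t: "t \<in> {0..T}"
        then have "norm (ys \<nu>' t - y t) < 1" using * by (simp add: dist_norm)
        then show "norm (ys \<nu>' t) \<le> B + 2"
          using y[OF t] norm_triangle_sub[of "ys \<nu>' t" "y t"] by simp
      qed
    qed simp
  qed
qed

section \<open>Consequences of the patchy structure\<close>

lemma patch: "\<alpha> \<in> A \<Longrightarrow> patch (P \<alpha>) (G \<alpha>)"
  and \<Omega>_eq: "\<Omega> = (\<Union>\<alpha>\<in>A. P \<alpha>)"
  and locally_finite: "compact K \<Longrightarrow> finite {\<alpha>\<in>A. P \<alpha> \<inter> K \<noteq> {}}"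
  and g_eq: "\<alpha> \<in> A \<Longrightarrow> x \<in> P \<alpha> \<Longrightarrow> (\<And>\<beta>. \<beta> \<in> A \<Longrightarrow> (\<alpha>, \<beta>) \<in> r \<Longrightarrow> \<alpha> \<noteq> \<beta> \<Longrightarrow> x \<notin> P \<beta>) \<Longrightarrow> g x = G \<alpha> x"
  and order: "linear_order_on A r"
  using patchy unfolding patchy_vector_field_def by blast+

lemma open_patch: "\<alpha> \<in> A \<Longrightarrow> open (P \<alpha>)"
  using patch by (simp add: patch_def)

lemma r_antisym: "(\<alpha>, \<beta>) \<in> r \<Longrightarrow> (\<beta>, \<alpha>) \<in> r \<Longrightarrow> \<alpha> = \<beta>"
  using order by (auto simp: order_on_defs dest: antisymD)

lemma isCont_field:
  assumes "\<alpha> \<in> A" "x \<in> closure (P \<alpha>)"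
  shows "isCont (G \<alpha>) x"
proof -
  obtain U where U: "open U" "closure (P \<alpha>) \<subseteq> U" "smooth_on U (G \<alpha>)"
    using patch[OF assms(1)] by (auto simp: patch_def)
  then have "Ck_on 0 U (G \<alpha>)" unfolding smooth_on_def by blast
  then show ?thesis using U assms(2) by (auto simp: continuous_on_eq_continuous_at)
qed

lemma ex_max_index:
  assumes "finite B" "B \<noteq> {}" "B \<subseteq> A"
  obtains \<alpha> where "\<alpha> \<in> B" "\<And>\<beta>. \<beta> \<in> B \<Longrightarrow> (\<beta>, \<alpha>) \<in> r"
proof -
  have r: "\<And>a. a \<in> A \<Longrightarrow> (a, a) \<in> r" "\<And>a b c. (a, b) \<in> r \<Longrightarrow> (b, c) \<in> r \<Longrightarrow> (a, c) \<in> r"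
    "\<And>a b. a \<in> A \<Longrightarrow> b \<in> A \<Longrightarrow> a \<noteq> b \<Longrightarrow> (a, b) \<in> r \<or> (b, a) \<in> r"
    using order by (auto simp: order_on_defs refl_on_def total_on_def dest: transD)
  have "\<exists>\<alpha>\<in>B. \<forall>\<beta>\<in>B. (\<beta>, \<alpha>) \<in> r"
    using assms
  proof (induction B rule: finite_ne_induct)
    case (singleton a)
    then show ?case using r(1) by auto
  next
    case (insert a B)
    then obtain \<alpha> where \<alpha>: "\<alpha> \<in> B" "\<forall>\<beta>\<in>B. (\<beta>, \<alpha>) \<in> r" by auto
    have "a \<in> A" "\<alpha> \<in> A" "a \<noteq> \<alpha>" using insert \<alpha> by auto
    then consider "(a, \<alpha>) \<in> r" | "(\<alpha>, a) \<in> r" using r(3) by blast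
    then show ?case
    proof cases
      case 1
      then show ?thesis using \<alpha> by auto
    next
      case 2
      then have "\<forall>\<beta>\<in>B. (\<beta>, a) \<in> r" using \<alpha> r(2) by blast
      then show ?thesis using r(1) \<open>a \<in> A\<close> by auto
    qed
  qed
  then show ?thesis using that by blast
qed

text \<open>The index order need not have maxima, but local finiteness at the single point
  \<open>x\<close> leaves finitely many patches to compare.\<close>

lemma ex_active_patch:
  assumes "x \<in> \<Omega>"
  obtains \<alpha> where "\<alpha> \<in> A" "x \<in> P \<alpha>" "g x = G \<alpha> x"
proof -
  define B where "B = {\<alpha>\<in>A. x \<in> P \<alpha>}"
  have "B = {\<alpha>\<in>A. P \<alpha> \<inter> {x} \<noteq> {}}" by (auto simp: B_def)
  then have "finite B" using locally_finite[of "{x}"] by simp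
  moreover have "B \<noteq> {}" "B \<subseteq> A" using assms by (auto simp: B_def \<Omega>_eq)
  ultimately obtain \<alpha> where \<alpha>: "\<alpha> \<in> B" "\<And>\<beta>. \<beta> \<in> B \<Longrightarrow> (\<beta>, \<alpha>) \<in> r"
    using ex_max_index by blast
  have "g x = G \<alpha> x"
  proof (rule g_eq)
    fix \<beta> assume "\<beta> \<in> A" "(\<alpha>, \<beta>) \<in> r" "\<alpha> \<noteq> \<beta>"
    then show "x \<notin> P \<beta>" using \<alpha>(2)[of \<beta>] r_antisym by (auto simp: B_def)
  qed (use \<alpha> in \<open>auto simp: B_def\<close>)
  then show ?thesis using that \<alpha>(1) by (auto simp: B_def)
qed

lemma ex_field_bound:
  obtains M where "M > 0"
    "\<And>\<alpha> x. \<alpha> \<in> A \<Longrightarrow> x \<in> closure (P \<alpha>) \<Longrightarrow> norm x \<le> R \<Longrightarrow> norm (G \<alpha> x) \<le> M"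
proof -
  \<comment> \<open>A closure that meets the ball of radius \<open>R\<close> may only touch it; the
    enlarged radius guarantees that the patch itself meets the ball.\<close>
  define F where "F = {\<alpha>\<in>A. P \<alpha> \<inter> cball 0 (R + 1) \<noteq> {}}"
  have "finite F" unfolding F_def by (rule locally_finite) simp
  have "\<forall>\<alpha>\<in>A. \<exists>B. \<forall>x\<in>closure (P \<alpha>) \<inter> cball 0 R. norm (G \<alpha> x) \<le> B"
  proof
    fix \<alpha> assume "\<alpha> \<in> A"
    then have "compact (G \<alpha> ` (closure (P \<alpha>) \<inter> cball 0 R))"
      by (intro compact_continuous_image closed_Int_compact continuous_at_imp_continuous_on ballI isCont_field) auto
    then show "\<exists>B. \<forall>x\<in>closure (P \<alpha>) \<inter> cball 0 R. norm (G \<alpha> x) \<le> B"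
      by (auto dest!: compact_imp_bounded simp: bounded_iff)
  qed
  then obtain B where B: "\<And>\<alpha> x. \<alpha> \<in> A \<Longrightarrow> x \<in> closure (P \<alpha>) \<Longrightarrow> norm x \<le> R \<Longrightarrow> norm (G \<alpha> x) \<le> B \<alpha>"
    by (metis IntI mem_cball_0)
  show ?thesis
  proof
    show "1 + (\<Sum>\<alpha>\<in>F. \<bar>B \<alpha>\<bar>) > 0" by (intro add_pos_nonneg sum_nonneg) auto
    fix \<alpha> x assume \<alpha>: "\<alpha> \<in> A" "x \<in> closure (P \<alpha>)" "norm x \<le> R"
    then obtain z where "z \<in> P \<alpha>" "dist z x < 1"
      using closure_approachable zero_less_one by blast
    then have "\<alpha> \<in> F"
      using \<alpha> norm_triangle_sub[of z x] by (auto simp: F_def dist_norm)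
    then have "\<bar>B \<alpha>\<bar> \<le> (\<Sum>\<alpha>\<in>F. \<bar>B \<alpha>\<bar>)"
      using \<open>finite F\<close> by (intro member_le_sum) auto
    then show "norm (G \<alpha> x) \<le> 1 + (\<Sum>\<alpha>\<in>F. \<bar>B \<alpha>\<bar>)"
      using B[OF \<alpha>] by linarith
  qed
qed

end

section \<open>Uniform bounds and Lipschitz continuity of the limit\<close>

text \<open>The bound \<open>M\<close> is required on closures because fields will also be frozen at
  frontier points.\<close>

locale bounded_patchy_limit = patchy_limit A r P G \<Omega> g T w ys y
  for A :: "'i set" and r :: "'i rel"
    and P :: "'i \<Rightarrow> 'a::euclidean_space set" and G :: "'i \<Rightarrow> 'a \<Rightarrow> 'a"
    and \<Omega> :: "'a set" and g :: "'a \<Rightarrow> 'a" and T :: real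
    and w ys :: "nat \<Rightarrow> real \<Rightarrow> 'a" and y :: "real \<Rightarrow> 'a" +
  fixes R M :: real
  assumes y_R: "\<And>t. t \<in> {0..T} \<Longrightarrow> norm (y t) \<le> R"
    and ys_R: "eventually (\<lambda>\<nu>. \<forall>t\<in>{0..T}. norm (ys \<nu> t) \<le> R) sequentially"
    and M_pos: "M > 0"
    and G_M: "\<And>\<alpha> x. \<alpha> \<in> A \<Longrightarrow> x \<in> closure (P \<alpha>) \<Longrightarrow> norm x \<le> R \<Longrightarrow> norm (G \<alpha> x) \<le> M"
begin

lemma g_M: "x \<in> \<Omega> \<Longrightarrow> norm x \<le> R \<Longrightarrow> norm (g x) \<le> M"
  using ex_active_patch G_M closure_subset by (metis subsetD)

definition good :: "nat \<Rightarrow> bool" where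
  "good \<nu> \<longleftrightarrow> \<nu> \<ge> 1 \<and> (\<forall>t\<in>{0..T}. norm (ys \<nu> t) \<le> R)"

lemma eventually_good: "eventually good sequentially"
  using ys_R eventually_ge_at_top[of "1::nat"] unfolding good_def by eventually_elim auto

lemma ys_lipschitz:
  assumes "good \<nu>" "0 \<le> s" "s \<le> t" "t \<le> T"
  shows "norm (ys \<nu> t - ys \<nu> s) \<le> M * (t - s) + (V \<nu> t - V \<nu> s)"
proof -
  have "norm (integral {s..t} (\<lambda>u. g (ys \<nu> u))) \<le> integral {s..t} (\<lambda>u. M)"
    using assms g_M ys_in by (intro integral_norm_bound_integral integrable) (auto simp: good_def)
  then have "norm (integral {s..t} (\<lambda>u. g (ys \<nu> u))) \<le> M * (t - s)"
    using assms by (simp add: mult.commute)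
  moreover have "norm (w \<nu> t - w \<nu> s) \<le> V \<nu> t - V \<nu> s"
    using assms by (intro w_increment) (auto simp: good_def)
  ultimately show ?thesis
    using assms by (subst ys_increment) (auto simp: good_def intro: norm_triangle_mono)
qed

text \<open>The jumps of an approximation are controlled by \<open>V \<nu>\<close>, which vanishes
  in the limit, leaving only the speed bound.\<close>

lemma y_lipschitz:
  assumes "s \<in> {0..T}" "t \<in> {0..T}"
  shows "norm (y t - y s) \<le> M * \<bar>t - s\<bar>"
proof -
  have le: "norm (y t - y s) \<le> M * (t - s)" if "0 \<le> s" "s \<le> t" "t \<le> T" for s t
  proof (rule tendsto_le[OF sequentially_bot])
    show "(\<lambda>\<nu>. norm (ys \<nu> t - ys \<nu> s)) \<longlonglongrightarrow> norm (y t - y s)"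
      using that by (intro tendsto_intros ys_tendsto) auto
    show "(\<lambda>\<nu>. M * (t - s) + V \<nu> T) \<longlonglongrightarrow> M * (t - s)"
      by (rule tendsto_eq_intros V_tendsto refl | simp)+
    show "eventually (\<lambda>\<nu>. norm (ys \<nu> t - ys \<nu> s) \<le> M * (t - s) + V \<nu> T) sequentially"
      using eventually_good
    proof eventually_elim
      case (elim \<nu>)
      then show ?case
        using ys_lipschitz[OF elim that] V_mono[of \<nu> t T] V_nonneg[of \<nu> s] that
        by (auto simp: good_def)
    qed
  qed
  show ?thesis
    using le[of s t] le[of t s] assms by (cases "s \<le> t") (auto simp: norm_minus_commute)
qed

lemma y_continuous: "continuous_on {0..T} y"
proof (rule lipschitz_on_continuous_on[of M])
  show "M-lipschitz_on {0..T} y"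
    using y_lipschitz M_pos by (intro lipschitz_onI) (auto simp: dist_norm)
qed

section \<open>Time spent in discarded patches\<close>

text \<open>The only patches that \<open>y\<close> and the good approximations can enter; this
  finite set is what the induction runs on.\<close>

definition F :: "'i set" where
  "F = {\<alpha>\<in>A. P \<alpha> \<inter> cball 0 R \<noteq> {}}"

definition hit :: "nat \<Rightarrow> 'i \<Rightarrow> real \<Rightarrow> real \<Rightarrow> real set" where
  "hit \<nu> \<beta> a b = {s\<in>{a..b}. ys \<nu> s \<in> P \<beta>}"

text \<open>\<open>D\<close> is the set of discarded patches. Absence of \<open>y\<close> would not
  suffice as an induction hypothesis: when \<open>y\<close> touches the boundary of an open patch,
  the approximations may be inside, and their time there has to vanish.\<close>

definition avoids :: "'i set \<Rightarrow> real \<Rightarrow> real \<Rightarrow> bool" where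
  "avoids D a b \<longleftrightarrow> 0 \<le> a \<and> b \<le> T \<and>
     (\<forall>\<beta>\<in>D. (\<forall>s\<in>{a..b}. y s \<notin> P \<beta>) \<and> (\<lambda>\<nu>. measure lebesgue (hit \<nu> \<beta> a b)) \<longlonglongrightarrow> 0)"

definition hits :: "nat \<Rightarrow> 'i set \<Rightarrow> real \<Rightarrow> real \<Rightarrow> real set" where
  "hits \<nu> D a b = (\<Union>\<beta>\<in>D. hit \<nu> \<beta> a b)"

lemma finite_F: "finite F" and F_subset: "F \<subseteq> A"
  unfolding F_def by (auto intro: locally_finite)

lemma mem_F: "\<alpha> \<in> A \<Longrightarrow> x \<in> P \<alpha> \<Longrightarrow> norm x \<le> R \<Longrightarrow> \<alpha> \<in> F"
  by (auto simp: F_def)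

lemma hit_lmeasurable:
  assumes "\<nu> \<ge> 1" "\<beta> \<in> A" "0 \<le> a" "b \<le> T"
  shows "hit \<nu> \<beta> a b \<in> lmeasurable"
proof (rule bounded_set_imp_lmeasurable)
  show "bounded (hit \<nu> \<beta> a b)"
    by (rule bounded_subset[OF bounded_closed_interval[of a b]]) (auto simp: hit_def)
  have "ys \<nu> \<in> borel_measurable (lebesgue_on {0..T})"
    using sol[OF assms(1)] unfolding perturbed_solution_def by blast
  then have "ys \<nu> -` P \<beta> \<inter> space (lebesgue_on {0..T}) \<in> sets (lebesgue_on {0..T})"
    by (rule measurable_sets) (use open_patch[OF assms(2)] in simp)
  then have "ys \<nu> -` P \<beta> \<inter> {0..T} \<in> sets lebesgue"
    by (simp add: sets_restrict_space_iff)
  then have "(ys \<nu> -` P \<beta> \<inter> {0..T}) \<inter> {a..b} \<in> sets lebesgue"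
    by (rule sets.Int) simp
  also have "(ys \<nu> -` P \<beta> \<inter> {0..T}) \<inter> {a..b} = hit \<nu> \<beta> a b"
    using assms by (auto simp: hit_def)
  finally show "hit \<nu> \<beta> a b \<in> sets lebesgue" .
qed

lemma hits_lmeasurable:
  "\<nu> \<ge> 1 \<Longrightarrow> D \<subseteq> F \<Longrightarrow> 0 \<le> a \<Longrightarrow> b \<le> T \<Longrightarrow> hits \<nu> D a b \<in> lmeasurable"
  unfolding hits_def
  using finite_F F_subset by (intro fmeasurable.finite_UN hit_lmeasurable) (auto intro: finite_subset)

lemma avoidsD:
  "avoids D a b \<Longrightarrow> 0 \<le> a" "avoids D a b \<Longrightarrow> b \<le> T"
  "avoids D a b \<Longrightarrow> \<beta> \<in> D \<Longrightarrow> s \<in> {a..b} \<Longrightarrow> y s \<notin> P \<beta>"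
  by (auto simp: avoids_def)

lemma avoids_subinterval:
  assumes "avoids D a b" "D \<subseteq> F" "a \<le> a'" "b' \<le> b"
  shows "avoids D a' b'"
proof -
  have "(\<lambda>\<nu>. measure lebesgue (hit \<nu> \<beta> a' b')) \<longlonglongrightarrow> 0" if "\<beta> \<in> D" for \<beta>
  proof (rule tendsto_sandwich[OF _ _ tendsto_const])
    show "(\<lambda>\<nu>. measure lebesgue (hit \<nu> \<beta> a b)) \<longlonglongrightarrow> 0"
      using assms(1) that by (auto simp: avoids_def)
    show "eventually (\<lambda>\<nu>. measure lebesgue (hit \<nu> \<beta> a' b') \<le> measure lebesgue (hit \<nu> \<beta> a b)) sequentially"
      using eventually_ge_at_top[of "1::nat"]
    proof eventually_elim
      case (elim \<nu>)
      then show ?case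
        using assms that F_subset avoidsD(1,2)[OF assms(1)]
        by (intro measure_mono_fmeasurable fmeasurableD hit_lmeasurable) (auto simp: hit_def)
    qed
  qed simp
  then show ?thesis using assms by (auto simp: avoids_def)
qed

lemma hits_tendsto:
  assumes "avoids D a b" "D \<subseteq> F"
  shows "(\<lambda>\<nu>. measure lebesgue (hits \<nu> D a b)) \<longlonglongrightarrow> 0"
proof (rule tendsto_sandwich[OF _ _ tendsto_const])
  have "(\<lambda>\<nu>. \<Sum>\<beta>\<in>D. measure lebesgue (hit \<nu> \<beta> a b)) \<longlonglongrightarrow> (\<Sum>\<beta>\<in>D. 0)"
    using assms(1) by (intro tendsto_sum) (auto simp: avoids_def)
  then show "(\<lambda>\<nu>. \<Sum>\<beta>\<in>D. measure lebesgue (hit \<nu> \<beta> a b)) \<longlonglongrightarrow> 0" by simp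
  show "eventually (\<lambda>\<nu>. measure lebesgue (hits \<nu> D a b) \<le> (\<Sum>\<beta>\<in>D. measure lebesgue (hit \<nu> \<beta> a b))) sequentially"
    using eventually_ge_at_top[of "1::nat"]
  proof eventually_elim
    case (elim \<nu>)
    then show ?case
      unfolding hits_def
      using assms finite_F F_subset avoidsD(1,2)[OF assms(1)]
      by (intro measure_UNION_le fmeasurableD hit_lmeasurable) (auto intro: finite_subset)
  qed
qed simp

text \<open>Recording the time in discarded patches cumulatively makes its contribution to an
  increment again an increment of a monotone function, so that it can be merged with
  \<open>V \<nu>\<close>.\<close>

definition hits_before :: "nat \<Rightarrow> 'i set \<Rightarrow> real \<Rightarrow> real \<Rightarrow> real \<Rightarrow> real" where
  "hits_before \<nu> D a b t = measure lebesgue (hits \<nu> D a b \<inter> {..t})"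

context
  fixes D :: "'i set" and a b :: real and \<nu> :: nat
  assumes D: "D \<subseteq> F" and ab: "0 \<le> a" "b \<le> T" and \<nu>: "\<nu> \<ge> 1"
begin

lemma hits_Int_lmeasurable: "S \<in> sets lebesgue \<Longrightarrow> hits \<nu> D a b \<inter> S \<in> lmeasurable"
  using hits_lmeasurable[OF \<nu> D ab] by (rule fmeasurable_Int_fmeasurable)

lemma hits_before_increment: "s \<le> t \<Longrightarrow> hits_before \<nu> D a b t - hits_before \<nu> D a b s = measure lebesgue (hits \<nu> D a b \<inter> {s<..t})"
proof -
  assume "s \<le> t"
  then have "hits \<nu> D a b \<inter> {..t} = (hits \<nu> D a b \<inter> {..s}) \<union> (hits \<nu> D a b \<inter> {s<..t})" by auto
  moreover have disj: "hits \<nu> D a b \<inter> {..s} \<inter> (hits \<nu> D a b \<inter> {s<..t}) = {}" by auto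
  ultimately have "hits_before \<nu> D a b t = hits_before \<nu> D a b s + measure lebesgue (hits \<nu> D a b \<inter> {s<..t})"
    unfolding hits_before_def using measure_Un3[of "hits \<nu> D a b \<inter> {..s}" lebesgue "hits \<nu> D a b \<inter> {s<..t}"]
    by (simp add: hits_Int_lmeasurable disj)
  then show ?thesis by simp
qed

lemma hits_before_mono: "s \<le> t \<Longrightarrow> hits_before \<nu> D a b s \<le> hits_before \<nu> D a b t"
  using hits_before_increment[of s t] measure_nonneg[of lebesgue "hits \<nu> D a b \<inter> {s<..t}"] by linarith

lemma hits_before_nonneg: "0 \<le> hits_before \<nu> D a b t"
  by (simp add: hits_before_def)

lemma hits_before_le: "hits_before \<nu> D a b t \<le> measure lebesgue (hits \<nu> D a b)"
  unfolding hits_before_def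
  by (rule measure_mono_fmeasurable[OF _ fmeasurableD[OF hits_Int_lmeasurable] hits_lmeasurable[OF \<nu> D ab]]) auto

end

section \<open>Motion inside the top remaining patch\<close>

text \<open>A higher patch containing \<open>x\<close> would lie in \<open>F\<close> by the norm
  bound; it is not in \<open>B\<close> by maximality of \<alpha>, and not in \<open>F - B\<close> by
  assumption.\<close>

lemma field_eq_top_patch:
  assumes "\<alpha> \<in> B" "\<And>\<beta>. \<beta> \<in> B \<Longrightarrow> (\<beta>, \<alpha>) \<in> r" "B \<subseteq> F"
    and "x \<in> P \<alpha>" "norm x \<le> R" "\<And>\<beta>. \<beta> \<in> F - B \<Longrightarrow> x \<notin> P \<beta>"
  shows "g x = G \<alpha> x"
proof (rule g_eq)
  fix \<beta> assume "\<beta> \<in> A" "(\<alpha>, \<beta>) \<in> r" "\<alpha> \<noteq> \<beta>"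
  then have "\<beta> \<notin> B" using assms(2) r_antisym by blast
  then show "x \<notin> P \<beta>" using mem_F[OF \<open>\<beta> \<in> A\<close>] assms(5,6) by blast
qed (use assms F_subset in auto)

text \<open>The field is frozen at \<open>x\<close>. Off the discarded patches the error is at most
  \<epsilon>, inside them it is at most \<open>2 * M\<close> because both fields are bounded by
  \<open>M\<close>, and the perturbation adds an increment of \<open>V \<nu>\<close>. Allowing
  \<open>x\<close> in the closure serves both the interior and the frontier case.\<close>

lemma increment_in_top_patch:
  assumes ab: "0 \<le> a" "b \<le> T"
    and \<alpha>: "\<alpha> \<in> B" "\<And>\<beta>. \<beta> \<in> B \<Longrightarrow> (\<beta>, \<alpha>) \<in> r" "B \<subseteq> F"
    and x: "x \<in> closure (P \<alpha>)" "norm x \<le> R"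
    and near: "\<And>z. z \<in> ball x \<rho> \<Longrightarrow> norm (G \<alpha> z - G \<alpha> x) \<le> \<epsilon>" and "\<epsilon> \<ge> 0"
    and \<nu>: "good \<nu>"
    and st: "a \<le> s" "s \<le> t" "t \<le> b"
    and inside: "\<And>u. u \<in> {s..<t} \<Longrightarrow> ys \<nu> u \<in> P \<alpha> \<inter> ball x \<rho>"
  shows "norm (ys \<nu> t - ys \<nu> s - (t - s) *\<^sub>R G \<alpha> x) \<le>
    \<epsilon> * (t - s) + 2 * M * (hits_before \<nu> (F - B) a b t - hits_before \<nu> (F - B) a b s) + (V \<nu> t - V \<nu> s)"
proof -
  let ?E = "hits \<nu> (F - B) a b \<inter> {s<..t}"
  have "\<nu> \<ge> 1" using \<nu> by (simp add: good_def)
  have st': "0 \<le> s" "t \<le> T" using st ab by auto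
  have E: "?E \<in> sets lebesgue"
    using \<open>\<nu> \<ge> 1\<close> ab by (intro fmeasurableD[OF hits_Int_lmeasurable]) auto
  have "norm (integral {s..t} (\<lambda>u. g (ys \<nu> u)) - (t - s) *\<^sub>R G \<alpha> x) \<le>
      \<epsilon> * (t - s) + 2 * M * measure lebesgue (?E \<inter> {s..t})"
  proof (rule norm_integral_minus_const_le[OF integrable _ E])
    fix u assume u: "s < u" "u < t"
    have Y: "ys \<nu> u \<in> P \<alpha>" "ys \<nu> u \<in> ball x \<rho>" "norm (ys \<nu> u) \<le> R" "ys \<nu> u \<in> \<Omega>"
      using inside[of u] u st' \<nu> ys_in[of \<nu> u] by (auto simp: good_def)
    show "norm (g (ys \<nu> u) - G \<alpha> x) \<le> \<epsilon> + 2 * M * indicator ?E u"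
    proof (cases "u \<in> ?E")
      case True
      have "norm (g (ys \<nu> u) - G \<alpha> x) \<le> norm (g (ys \<nu> u)) + norm (G \<alpha> x)"
        by (rule norm_triangle_ineq4)
      also have "\<dots> \<le> M + M"
        using \<alpha> F_subset x Y by (intro add_mono g_M G_M) auto
      finally show ?thesis using True \<open>\<epsilon> \<ge> 0\<close> by simp
    next
      case False
      have "g (ys \<nu> u) = G \<alpha> (ys \<nu> u)"
      proof (rule field_eq_top_patch[OF \<alpha> Y(1,3)])
        fix \<beta> assume "\<beta> \<in> F - B"
        then show "ys \<nu> u \<notin> P \<beta>"
          using False u st by (auto simp: hits_def hit_def)
      qed
      then show ?thesis using False near[OF Y(2)] by simp
    qed
  qed (use \<open>\<nu> \<ge> 1\<close> st st' in auto)
  moreover have "?E \<inter> {s..t} = ?E" by auto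
  moreover have "measure lebesgue ?E = hits_before \<nu> (F - B) a b t - hits_before \<nu> (F - B) a b s"
    using \<open>\<nu> \<ge> 1\<close> ab st by (intro hits_before_increment[symmetric]) auto
  ultimately have drift: "norm (integral {s..t} (\<lambda>u. g (ys \<nu> u)) - (t - s) *\<^sub>R G \<alpha> x) \<le>
      \<epsilon> * (t - s) + 2 * M * (hits_before \<nu> (F - B) a b t - hits_before \<nu> (F - B) a b s)"
    by simp
  have "norm (w \<nu> t - w \<nu> s) \<le> V \<nu> t - V \<nu> s"
    using \<open>\<nu> \<ge> 1\<close> st st' by (intro w_increment) auto
  moreover have "ys \<nu> t - ys \<nu> s - (t - s) *\<^sub>R G \<alpha> x =
      (integral {s..t} (\<lambda>u. g (ys \<nu> u)) - (t - s) *\<^sub>R G \<alpha> x) + (w \<nu> t - w \<nu> s)"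
    using ys_increment[OF \<open>\<nu> \<ge> 1\<close> st'(1) st(2) st'(2)] by simp
  ultimately show ?thesis
    using norm_triangle_mono[OF drift] by (simp only:)
qed

lemma field_near:
  assumes "\<alpha> \<in> A" "x \<in> closure (P \<alpha>)" "\<epsilon> > 0"
  obtains \<rho> where "\<rho> > 0" "\<And>z. z \<in> ball x \<rho> \<Longrightarrow> norm (G \<alpha> z - G \<alpha> x) \<le> \<epsilon>"
proof -
  from isCont_field[OF assms(1,2)] assms(3) obtain \<rho> where
    "\<rho> > 0" "\<And>z. dist z x < \<rho> \<Longrightarrow> dist (G \<alpha> z) (G \<alpha> x) < \<epsilon>"
    unfolding continuous_at_eps_delta by blast
  then show ?thesis using that[of \<rho>] by (auto simp: dist_commute dist_norm less_imp_le)
qed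

text \<open>In the limit both the time in discarded patches and the variation vanish, so only
  \<epsilon> survives. The radius \<open>\<rho> / 2\<close> for \<open>y\<close> leaves room for the
  approximations to stay in the ball of radius \<rho>.\<close>

lemma y_increment_in_top_patch:
  assumes av: "avoids (F - B) a b"
    and \<alpha>: "\<alpha> \<in> B" "\<And>\<beta>. \<beta> \<in> B \<Longrightarrow> (\<beta>, \<alpha>) \<in> r" "B \<subseteq> F"
    and x: "x \<in> P \<alpha>" "norm x \<le> R"
    and near: "\<And>z. z \<in> ball x \<rho> \<Longrightarrow> norm (G \<alpha> z - G \<alpha> x) \<le> \<epsilon>" and "\<epsilon> \<ge> 0" "\<rho> > 0"
    and P: "ball x \<rho> \<subseteq> P \<alpha>"
    and st: "a \<le> s" "s \<le> t" "t \<le> b"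
    and inside: "\<And>u. u \<in> {s..t} \<Longrightarrow> y u \<in> ball x (\<rho> / 2)"
  shows "norm (y t - y s - (t - s) *\<^sub>R G \<alpha> x) \<le> \<epsilon> * (t - s)"
proof (rule tendsto_le[OF sequentially_bot])
  have ab: "0 \<le> a" "b \<le> T" using avoidsD(1,2)[OF av] .
  show "(\<lambda>\<nu>. norm (ys \<nu> t - ys \<nu> s - (t - s) *\<^sub>R G \<alpha> x)) \<longlonglongrightarrow> norm (y t - y s - (t - s) *\<^sub>R G \<alpha> x)"
    using st ab by (intro tendsto_intros ys_tendsto) auto
  have "(\<lambda>\<nu>. \<epsilon> * (t - s) + 2 * M * measure lebesgue (hits \<nu> (F - B) a b) + V \<nu> T) \<longlonglongrightarrow>
      \<epsilon> * (t - s) + 2 * M * 0 + 0"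
    by (intro tendsto_intros V_tendsto hits_tendsto av) auto
  then show "(\<lambda>\<nu>. \<epsilon> * (t - s) + 2 * M * measure lebesgue (hits \<nu> (F - B) a b) + V \<nu> T) \<longlonglongrightarrow> \<epsilon> * (t - s)"
    by simp
  have "eventually (\<lambda>\<nu>. \<forall>t\<in>{0..T}. dist (ys \<nu> t) (y t) < \<rho> / 2) sequentially"
    using \<open>\<rho> > 0\<close> by (intro eventually_close) auto
  then show "eventually (\<lambda>\<nu>. norm (ys \<nu> t - ys \<nu> s - (t - s) *\<^sub>R G \<alpha> x) \<le>
      \<epsilon> * (t - s) + 2 * M * measure lebesgue (hits \<nu> (F - B) a b) + V \<nu> T) sequentially"
    using eventually_good
  proof eventually_elim
    case (elim \<nu>)
    then have "\<nu> \<ge> 1" by (simp add: good_def)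
    have "norm (ys \<nu> t - ys \<nu> s - (t - s) *\<^sub>R G \<alpha> x) \<le>
      \<epsilon> * (t - s) + 2 * M * (hits_before \<nu> (F - B) a b t - hits_before \<nu> (F - B) a b s) + (V \<nu> t - V \<nu> s)"
    proof (rule increment_in_top_patch[OF ab \<alpha> _ x(2) near \<open>\<epsilon> \<ge> 0\<close> elim(2) st])
      fix u assume u: "u \<in> {s..<t}"
      then have "dist (ys \<nu> u) (y u) < \<rho> / 2" using elim(1) st ab by auto
      moreover have "dist x (y u) < \<rho> / 2" using inside[of u] u by simp
      ultimately have "ys \<nu> u \<in> ball x \<rho>"
        using dist_triangle_half_r[of "y u" x \<rho> "ys \<nu> u"] by (simp add: dist_commute)
      then show "ys \<nu> u \<in> P \<alpha> \<inter> ball x \<rho>" using P by auto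
    qed (use x closure_subset in auto)
    also have "hits_before \<nu> (F - B) a b t - hits_before \<nu> (F - B) a b s \<le> measure lebesgue (hits \<nu> (F - B) a b)"
      using hits_before_le[of "F - B" a b \<nu> t] hits_before_nonneg[of "F - B" a b \<nu> s] ab \<open>\<nu> \<ge> 1\<close> by auto
    also have "V \<nu> t - V \<nu> s \<le> V \<nu> T"
      using V_mono[of \<nu> t T] V_nonneg[of \<nu> s] \<open>\<nu> \<ge> 1\<close> st ab by auto
    finally show ?case using M_pos by simp
  qed
qed

lemma y_near:
  assumes "t \<in> {0..T}" "\<rho> > 0"
  obtains d where "d > 0" "\<And>s. s \<in> {0..T} \<Longrightarrow> \<bar>s - t\<bar> < d \<Longrightarrow> y s \<in> ball (y t) \<rho>"
proof
  show "\<rho> / M > 0" using assms M_pos by simp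
  show "y s \<in> ball (y t) \<rho>" if "s \<in> {0..T}" "\<bar>s - t\<bar> < \<rho> / M" for s
  proof -
    have "norm (y t - y s) \<le> M * \<bar>t - s\<bar>" using y_lipschitz assms that by blast
    also have "\<dots> < \<rho>" using that(2) M_pos by (simp add: field_simps abs_minus_commute)
    finally show ?thesis by (simp add: dist_norm)
  qed
qed

lemma derivative_in_top_patch:
  assumes av: "avoids (F - B) a b"
    and \<alpha>: "\<alpha> \<in> B" "\<And>\<beta>. \<beta> \<in> B \<Longrightarrow> (\<beta>, \<alpha>) \<in> r" "B \<subseteq> F"
    and t: "a < t" "t < b" "y t \<in> P \<alpha>"
  shows "(y has_vector_derivative G \<alpha> (y t)) (at t)"
  unfolding has_vector_derivative_def has_derivative_at_alt
proof (intro conjI allI impI)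
  have ab: "0 \<le> a" "b \<le> T" using avoidsD(1,2)[OF av] .
  have tT: "t \<in> {0..T}" using t ab by auto
  have "\<alpha> \<in> A" using \<alpha> F_subset by auto
  show "bounded_linear (\<lambda>h. h *\<^sub>R G \<alpha> (y t))" by (rule bounded_linear_scaleR_left)
  fix \<epsilon> :: real assume "\<epsilon> > 0"
  obtain \<rho>1 where \<rho>1: "\<rho>1 > 0" "\<And>z. z \<in> ball (y t) \<rho>1 \<Longrightarrow> norm (G \<alpha> z - G \<alpha> (y t)) \<le> \<epsilon>"
    using field_near[OF \<open>\<alpha> \<in> A\<close> _ \<open>\<epsilon> > 0\<close>, of "y t"] t(3) closure_subset by blast
  obtain \<rho>2 where \<rho>2: "\<rho>2 > 0" "ball (y t) \<rho>2 \<subseteq> P \<alpha>"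
    using open_patch[OF \<open>\<alpha> \<in> A\<close>] t(3) by (auto simp: open_contains_ball)
  define \<rho> where "\<rho> = min \<rho>1 \<rho>2"
  have \<rho>: "\<rho> > 0" "ball (y t) \<rho> \<subseteq> P \<alpha>" "\<And>z. z \<in> ball (y t) \<rho> \<Longrightarrow> norm (G \<alpha> z - G \<alpha> (y t)) \<le> \<epsilon>"
    using \<rho>1 \<rho>2 by (auto simp: \<rho>_def subset_eq)
  obtain d0 where d0: "d0 > 0" "\<And>s. s \<in> {0..T} \<Longrightarrow> \<bar>s - t\<bar> < d0 \<Longrightarrow> y s \<in> ball (y t) (\<rho> / 2)"
    using y_near[OF tT, of "\<rho> / 2"] \<rho>(1) by auto
  define d where "d = min d0 (min (t - a) (b - t))"
  have "d > 0" using d0 t by (simp add: d_def)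
  \<comment> \<open>Stated for an arbitrary ordered pair around \<open>t\<close>, so that one
    estimate yields both one-sided difference quotients.\<close>
  have key: "norm (y q - y p - (q - p) *\<^sub>R G \<alpha> (y t)) \<le> \<epsilon> * (q - p)"
    if pq: "t - d < p" "p \<le> q" "q < t + d" for p q
  proof (rule y_increment_in_top_patch[OF av \<alpha> t(3) y_R[OF tT] \<rho>(3) _ \<rho>(1,2) _ pq(2)])
    show "y u \<in> ball (y t) (\<rho> / 2)" if "u \<in> {p..q}" for u
      using that pq ab by (intro d0(2)) (auto simp: d_def)
  qed (use pq \<open>\<epsilon> > 0\<close> in \<open>auto simp: d_def\<close>)
  have "norm (y s - y t - (s - t) *\<^sub>R G \<alpha> (y t)) \<le> \<epsilon> * norm (s - t)" if "norm (s - t) < d" for s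
  proof (cases "s \<ge> t")
    case True
    then show ?thesis using key[of t s] that \<open>d > 0\<close> by (auto simp: abs_if)
  next
    case False
    have "norm (y t - y s - (t - s) *\<^sub>R G \<alpha> (y t)) = norm (y s - y t - (s - t) *\<^sub>R G \<alpha> (y t))"
      by (subst norm_minus_cancel[symmetric]) (simp add: algebra_simps)
    then show ?thesis using key[of s t] False that \<open>d > 0\<close> by (auto simp: abs_if)
  qed
  then show "\<exists>d>0. \<forall>s. norm (s - t) < d \<longrightarrow>
      norm (y s - y t - (s - t) *\<^sub>R G \<alpha> (y t)) \<le> \<epsilon> * norm (s - t)"
    using \<open>d > 0\<close> by blast
qed

subsection \<open>Behaviour at the boundary of the top patch\<close>

text \<open>The last inequality balances the inward drift against its two losses:
  \<open>norm D * \<epsilon>\<close> from the variation of the field, and \<open>\<eta> * M\<close>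
  from the nonlinearity of \<phi> along a motion of speed at most \<open>M\<close>.\<close>

lemma boundary_chart:
  assumes "\<alpha> \<in> A" and x: "x \<in> frontier (P \<alpha>)"
  obtains \<kappa> \<epsilon> \<eta> \<rho> \<phi> D where "\<kappa> > 0" "\<epsilon> \<ge> 0" "\<eta> \<ge> 0" "\<rho> > 0"
    "\<And>z. z \<in> ball x \<rho> \<Longrightarrow> z \<in> P \<alpha> \<longleftrightarrow> \<phi> z < (0::real)"
    "\<And>p q. p \<in> ball x \<rho> \<Longrightarrow> q \<in> ball x \<rho> \<Longrightarrow> \<phi> p - \<phi> q \<le> D \<bullet> (p - q) + \<eta> * norm (p - q)"
    "\<And>z. z \<in> ball x \<rho> \<Longrightarrow> norm (G \<alpha> z - G \<alpha> x) \<le> \<epsilon>"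
    "D \<bullet> G \<alpha> x + norm D * \<epsilon> + \<eta> * M \<le> - \<kappa>"
proof -
  from patch[OF \<open>\<alpha> \<in> A\<close>] have "smooth_boundary (P \<alpha>)" "G \<alpha> x \<bullet> outer_normal (P \<alpha>) x < 0"
    using x by (auto simp: patch_def)
  then obtain U \<phi> where U\<phi>: "local_defining_function (P \<alpha>) x U \<phi>"
    using x unfolding smooth_boundary_def by blast
  then have U: "open U" "x \<in> U" "smooth_on U \<phi>" "P \<alpha> \<inter> U = {z \<in> U. \<phi> z < 0}"
    and "\<exists>D. GDERIV \<phi> x :> D \<and> D \<noteq> 0"
    unfolding local_defining_function_def by blast+
  then obtain D where D: "GDERIV \<phi> x :> D" "D \<noteq> 0" by blast
  have "D \<bullet> G \<alpha> x < 0"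
    using \<open>G \<alpha> x \<bullet> outer_normal (P \<alpha>) x < 0\<close> D
    by (simp add: outer_normal_eq[OF U\<phi> x D(1)] inner_commute mult_less_0_iff)
  \<comment> \<open>A quarter of the drift: \<epsilon> and \<eta> are chosen so that each loss costs
    exactly \<kappa>, and the remaining \<open>- 2 * \<kappa>\<close> is below
    \<open>- \<kappa>\<close>.\<close>
  define \<kappa> where "\<kappa> = - (D \<bullet> G \<alpha> x) / 4"
  define \<epsilon> where "\<epsilon> = \<kappa> / norm D"
  define \<eta> where "\<eta> = \<kappa> / M"
  have "\<kappa> > 0" using \<open>D \<bullet> G \<alpha> x < 0\<close> by (simp add: \<kappa>_def)
  then have pos: "\<kappa> > 0" "\<epsilon> > 0" "\<eta> > 0"
    using D M_pos by (simp_all add: \<epsilon>_def \<eta>_def)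
  obtain \<rho>1 where \<rho>1: "\<rho>1 > 0" "ball x \<rho>1 \<subseteq> U"
    "\<And>p q. p \<in> ball x \<rho>1 \<Longrightarrow> q \<in> ball x \<rho>1 \<Longrightarrow> \<bar>\<phi> p - \<phi> q - D \<bullet> (p - q)\<bar> \<le> \<eta> * norm (p - q)"
    using smooth_on_strictly_differentiable[OF U(1-3) D(1) pos(3)] by blast
  have "x \<in> closure (P \<alpha>)" using x by (simp add: frontier_def)
  then obtain \<rho>2 where \<rho>2: "\<rho>2 > 0" "\<And>z. z \<in> ball x \<rho>2 \<Longrightarrow> norm (G \<alpha> z - G \<alpha> x) \<le> \<epsilon>"
    using field_near[OF \<open>\<alpha> \<in> A\<close> _ pos(2)] by blast
  show ?thesis
  proof (rule that[of \<kappa> \<epsilon> \<eta> "min \<rho>1 \<rho>2" \<phi> D])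
    show "z \<in> P \<alpha> \<longleftrightarrow> \<phi> z < 0" if "z \<in> ball x (min \<rho>1 \<rho>2)" for z
      using U(4) \<rho>1(2) that by auto
    show "\<phi> p - \<phi> q \<le> D \<bullet> (p - q) + \<eta> * norm (p - q)"
      if "p \<in> ball x (min \<rho>1 \<rho>2)" "q \<in> ball x (min \<rho>1 \<rho>2)" for p q
      using \<rho>1(3)[of p q] that by auto
    show "norm (G \<alpha> z - G \<alpha> x) \<le> \<epsilon>" if "z \<in> ball x (min \<rho>1 \<rho>2)" for z
      using \<rho>2(2)[of z] that by auto
    have "norm D * \<epsilon> = \<kappa>" "\<eta> * M = \<kappa>" "D \<bullet> G \<alpha> x = - 4 * \<kappa>"
      using D M_pos by (auto simp: \<epsilon>_def \<eta>_def \<kappa>_def)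
    then show "D \<bullet> G \<alpha> x + norm D * \<epsilon> + \<eta> * M \<le> - \<kappa>" using pos by simp
  qed (use pos \<rho>1 \<rho>2 in auto)
qed

context
  fixes B a b \<alpha> x \<phi> D \<kappa> \<epsilon> \<eta> \<rho>
  assumes av: "avoids (F - B) a b"
    and \<alpha>: "\<alpha> \<in> B" "\<And>\<beta>. \<beta> \<in> B \<Longrightarrow> (\<beta>, \<alpha>) \<in> r" "B \<subseteq> F"
    and x: "x \<in> frontier (P \<alpha>)" "norm x \<le> R"
    and pos: "\<kappa> > 0" "\<epsilon> \<ge> 0" "\<eta> \<ge> 0" "\<rho> > 0"
    and below: "\<And>z. z \<in> ball x \<rho> \<Longrightarrow> z \<in> P \<alpha> \<longleftrightarrow> \<phi> z < (0::real)"
    and lin: "\<And>p q. p \<in> ball x \<rho> \<Longrightarrow> q \<in> ball x \<rho> \<Longrightarrow> \<phi> p - \<phi> q \<le> D \<bullet> (p - q) + \<eta> * norm (p - q)"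
    and near: "\<And>z. z \<in> ball x \<rho> \<Longrightarrow> norm (G \<alpha> z - G \<alpha> x) \<le> \<epsilon>"
    and drift: "D \<bullet> G \<alpha> x + norm D * \<epsilon> + \<eta> * M \<le> - \<kappa>"
begin

lemma no_exit_near_boundary:
  assumes st: "a \<le> s" "s \<le> t" "t \<le> b"
    and ball: "\<And>u. u \<in> {s..t} \<Longrightarrow> y u \<in> ball x \<rho>"
    and s: "y s \<in> P \<alpha>"
  shows "y t \<in> P \<alpha>"
proof (rule ccontr)
  assume "y t \<notin> P \<alpha>"
  have ab: "0 \<le> a" "b \<le> T" using avoidsD(1,2)[OF av] .
  have cont: "continuous_on {s..t} y"
    by (rule continuous_on_subset[OF y_continuous]) (use st ab in auto)
  define Z where "Z = {u\<in>{s..t}. y u \<in> - P \<alpha>}"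
  have "\<alpha> \<in> A" using \<alpha> F_subset by auto
  have "closed Z" unfolding Z_def
    using continuous_closed_preimage[OF cont closed_atLeastAtMost, of "- P \<alpha>"] open_patch[OF \<open>\<alpha> \<in> A\<close>]
    by (simp add: vimage_def Int_def conj_commute closed_Compl)
  have Z: "Z \<noteq> {}" "bdd_below Z" using \<open>y t \<notin> P \<alpha>\<close> st by (auto simp: Z_def)
  \<comment> \<open>The first exit time. It belongs to \<open>Z\<close> because
    \<open>P \<alpha>\<close> is open, and before it the limit moves by the smooth field
    \<open>G \<alpha>\<close>.\<close>
  define q where "q = Inf Z"
  have "q \<in> Z" unfolding q_def by (rule closed_contains_Inf[OF Z \<open>closed Z\<close>])
  then have q: "s < q" "q \<le> t" "y q \<notin> P \<alpha>"
    using s by (auto simp: Z_def less_le)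
  have in_P: "y u \<in> P \<alpha>" if "s \<le> u" "u < q" for u
    using cInf_lower[OF _ Z(2), of u] that q by (auto simp: q_def Z_def not_less[symmetric])
  have cont_D: "continuous_on {s..q} (\<lambda>u. D \<bullet> y u)"
    using q by (intro continuous_intros continuous_on_subset[OF cont]) auto
  have deriv: "((\<lambda>u. D \<bullet> y u) has_derivative (\<lambda>h. h * (D \<bullet> G \<alpha> (y u)))) (at u)" if "s < u" "u < q" for u
  proof -
    have "(y has_derivative (\<lambda>h. h *\<^sub>R G \<alpha> (y u))) (at u)"
      using derivative_in_top_patch[OF av \<alpha>, of u] in_P[of u] that q st
      by (auto simp: has_vector_derivative_def)
    then show ?thesis by (auto intro!: derivative_eq_intros)
  qed
  \<comment> \<open>The mean value theorem is applied to the linear functional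
    \<open>D \<bullet> y\<close>; passing to \<phi> afterwards costs only the remainder with factor
    \<eta>.\<close>
  obtain u where u: "s < u" "u < q" "D \<bullet> y q - D \<bullet> y s = (q - s) * (D \<bullet> G \<alpha> (y u))"
    using mvt[OF \<open>s < q\<close> cont_D deriv] by blast
  have "D \<bullet> G \<alpha> (y u) = D \<bullet> G \<alpha> x + D \<bullet> (G \<alpha> (y u) - G \<alpha> x)" by (simp add: inner_diff_right)
  also have "D \<bullet> (G \<alpha> (y u) - G \<alpha> x) \<le> norm D * norm (G \<alpha> (y u) - G \<alpha> x)" by (rule norm_cauchy_schwarz)
  also have "\<dots> \<le> norm D * \<epsilon>" using near[OF ball] u q by (intro mult_left_mono) auto
  finally have "D \<bullet> G \<alpha> (y u) + \<eta> * M \<le> - \<kappa>" using drift by linarith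
  have "\<phi> (y q) - \<phi> (y s) \<le> D \<bullet> (y q - y s) + \<eta> * norm (y q - y s)"
    using q st by (intro lin ball) auto
  also have "\<dots> \<le> (q - s) * (D \<bullet> G \<alpha> (y u)) + \<eta> * (M * (q - s))"
    using y_lipschitz[of s q] q st ab u pos by (intro add_mono mult_left_mono) (auto simp: inner_diff_right)
  also have "\<dots> = (q - s) * (D \<bullet> G \<alpha> (y u) + \<eta> * M)" by (simp add: algebra_simps)
  also have "\<dots> \<le> (q - s) * (- \<kappa>)"
    using \<open>D \<bullet> G \<alpha> (y u) + \<eta> * M \<le> - \<kappa>\<close> q by (intro mult_left_mono) auto
  also have "\<dots> \<le> 0" using q pos by (simp add: mult_nonneg_nonpos)
  finally have "\<phi> (y q) \<le> \<phi> (y s)" by simp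
  moreover have "\<phi> (y s) < 0" using below[OF ball] s st by auto
  ultimately show False using below[OF ball, of q] q by auto
qed

text \<open>While an approximation is inside the top patch, \<open>\<phi>\<close> decreases along it at rate at
  least \<open>\<kappa>\<close>, so only the perturbation can bring it back out. Hence the time spent inside is
  controlled by the total variation of the perturbation.\<close>

lemma hitting_time_near_boundary:
  assumes ab': "a \<le> a'" "a' \<le> b'" "b' \<le> b"
    and ball: "\<And>u. u \<in> {a'..b'} \<Longrightarrow> y u \<in> ball x (\<rho> / 2)"
    and out: "\<And>u. u \<in> {a'..b'} \<Longrightarrow> y u \<notin> P \<alpha>"
  shows "(\<lambda>\<nu>. measure lebesgue (hit \<nu> \<alpha> a' b')) \<longlonglongrightarrow> 0"
proof (rule tendsto_sandwich[OF _ _ tendsto_const])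
  let ?L = "norm D + \<eta>"
  let ?bound = "\<lambda>\<nu>. 5 / \<kappa> * (?L * V \<nu> T + 2 * M * norm D * measure lebesgue (hits \<nu> (F - B) a b) +
      ?L * norm (y b' - ys \<nu> b'))"
  have ab: "0 \<le> a" "b \<le> T" using avoidsD(1,2)[OF av] .
  have "(\<lambda>\<nu>. norm (y b' - ys \<nu> b')) \<longlonglongrightarrow> norm (y b' - y b')"
    using ab ab' by (intro tendsto_intros ys_tendsto) auto
  then have "?bound \<longlonglongrightarrow> 5 / \<kappa> * (?L * 0 + 2 * M * norm D * 0 + ?L * 0)"
    by (intro tendsto_intros V_tendsto hits_tendsto av) auto
  then show "?bound \<longlonglongrightarrow> 0" by simp
  have "eventually (\<lambda>\<nu>. \<forall>t\<in>{0..T}. dist (ys \<nu> t) (y t) < \<rho> / 2) sequentially"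
    using pos by (intro eventually_close) auto
  then show "eventually (\<lambda>\<nu>. measure lebesgue (hit \<nu> \<alpha> a' b') \<le> ?bound \<nu>) sequentially"
    using eventually_good
  proof eventually_elim
    case (elim \<nu>)
    then have "\<nu> \<ge> 1" by (simp add: good_def)
    have Y: "ys \<nu> u \<in> ball x \<rho>" if "u \<in> {a'..b'}" for u
    proof -
      have "dist (ys \<nu> u) (y u) < \<rho> / 2" using elim(1) that ab ab' by auto
      moreover have "dist x (y u) < \<rho> / 2" using ball[OF that] by simp
      ultimately show ?thesis
        using dist_triangle_half_r[of "y u" x \<rho> "ys \<nu> u"] by (simp add: dist_commute)
    qed
    have yb: "y b' \<in> ball x \<rho>" using ball[of b'] ab' pos by auto
    define h where "h = (\<lambda>t. \<phi> (ys \<nu> t))"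
    define E where "E = hits_before \<nu> (F - B) a b"
    \<comment> \<open>All errors in one monotone function: the perturbation acts on the linear part
      of \<phi> with factor \<open>norm D\<close> and on the remainder with factor \<eta>, while
      discarded patches act with velocity error up to \<open>2 * M\<close> on the linear
      part.\<close>
    define W where "W = (\<lambda>t. ?L * V \<nu> t + 2 * M * norm D * E t)"
    have E: "E s \<le> E t" if "s \<le> t" for s t
      unfolding E_def using that \<open>\<nu> \<ge> 1\<close> ab by (intro hits_before_mono) auto
    have lip: "norm (ys \<nu> t - ys \<nu> s) \<le> M * (t - s) + (V \<nu> t - V \<nu> s)" if "a' \<le> s" "s \<le> t" "t \<le> b'" for s t
      using that ab ab' by (intro ys_lipschitz elim) auto
    have L: "?L \<ge> 0" and MD: "2 * M * norm D \<ge> 0" using pos M_pos by auto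
    have VW: "V \<nu> s \<le> V \<nu> t" "?L * (V \<nu> t - V \<nu> s) \<le> W t - W s" "W s \<le> W t"
      if "a' \<le> s" "s \<le> t" "t \<le> b'" for s t
    proof -
      show V: "V \<nu> s \<le> V \<nu> t" using that ab ab' \<open>\<nu> \<ge> 1\<close> by (intro V_mono) auto
      show *: "?L * (V \<nu> t - V \<nu> s) \<le> W t - W s"
        using mult_left_mono[OF E[OF that(2)] MD] by (simp add: W_def algebra_simps)
      have "0 \<le> ?L * (V \<nu> t - V \<nu> s)" using L V by simp
      then show "W s \<le> W t" using * by linarith
    qed
    \<comment> \<open>At time \<open>b'\<close> the limit is outside, where \<phi> is nonnegative,
      so the approximation can be only slightly below level zero. This is the terminal debt in
      \<open>measure_below_level_le\<close>.\<close>
    have end_bound: "- h b' \<le> ?L * norm (y b' - ys \<nu> b')"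
    proof -
      have "- h b' \<le> \<phi> (y b') - \<phi> (ys \<nu> b')"
        using below[OF yb] out[of b'] ab' by (simp add: h_def not_less)
      also have "\<dots> \<le> D \<bullet> (y b' - ys \<nu> b') + \<eta> * norm (y b' - ys \<nu> b')"
        using Y[of b'] yb ab' by (intro lin) auto
      also have "\<dots> \<le> ?L * norm (y b' - ys \<nu> b')"
        using norm_cauchy_schwarz[of D "y b' - ys \<nu> b'"] by (simp add: algebra_simps)
      finally show ?thesis .
    qed
    have "measure lebesgue (hit \<nu> \<alpha> a' b') \<le> 5 / \<kappa> * (W b' - W a' + ?L * norm (y b' - ys \<nu> b'))"
    proof (rule measure_below_level_le[OF ab'(2), where h = h and C = "?L * M"])
      show "mono_on {a'..b'} W" using VW(3) by (auto intro: mono_onI)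
      show "hit \<nu> \<alpha> a' b' \<in> sets lebesgue"
        using \<alpha> F_subset \<open>\<nu> \<ge> 1\<close> ab ab' by (intro fmeasurableD hit_lmeasurable) auto
      show "hit \<nu> \<alpha> a' b' \<subseteq> {a'..b'}" by (auto simp: hit_def)
      show "u \<in> hit \<nu> \<alpha> a' b' \<longleftrightarrow> h u < 0" if "u \<in> {a'..b'}" for u
        using below[OF Y[OF that]] that by (simp add: hit_def h_def)
      show "- (?L * norm (y b' - ys \<nu> b')) \<le> h b'" using end_bound by simp
      show "0 \<le> ?L * norm (y b' - ys \<nu> b')" using L by simp
      show "0 \<le> ?L * M" using L M_pos by simp
      fix s t assume st: "a' \<le> s" "s \<le> t" "t \<le> b'"
      have h: "h t - h s \<le> D \<bullet> (ys \<nu> t - ys \<nu> s) + \<eta> * norm (ys \<nu> t - ys \<nu> s)"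
        unfolding h_def using Y st by (intro lin) auto
      show "h t - h s \<le> ?L * M * (t - s) + (W t - W s)"
      proof -
        have "h t - h s \<le> ?L * norm (ys \<nu> t - ys \<nu> s)"
          using h norm_cauchy_schwarz[of D "ys \<nu> t - ys \<nu> s"] by (simp add: algebra_simps)
        also have "\<dots> \<le> ?L * (M * (t - s) + (V \<nu> t - V \<nu> s))"
          using lip[OF st] L by (rule mult_left_mono)
        also have "\<dots> = ?L * M * (t - s) + ?L * (V \<nu> t - V \<nu> s)" by (simp add: algebra_simps)
        finally show ?thesis using VW(2)[OF st] by linarith
      qed
      assume J: "{s..<t} \<subseteq> hit \<nu> \<alpha> a' b'"
      show "h t - h s \<le> - \<kappa> * (t - s) + (W t - W s)"
      proof -
        have inc: "norm (ys \<nu> t - ys \<nu> s - (t - s) *\<^sub>R G \<alpha> x) \<le>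
            \<epsilon> * (t - s) + 2 * M * (E t - E s) + (V \<nu> t - V \<nu> s)" (is "_ \<le> ?err")
          unfolding E_def
        proof (rule increment_in_top_patch[OF ab \<alpha> _ x(2) near pos(2) elim(2)])
          show "x \<in> closure (P \<alpha>)" using x by (simp add: frontier_def)
          show "ys \<nu> u \<in> P \<alpha> \<inter> ball x \<rho>" if "u \<in> {s..<t}" for u
            using J Y[of u] that st by (auto simp: hit_def)
        qed (use st ab' in auto)
        have "D \<bullet> (ys \<nu> t - ys \<nu> s) = (t - s) * (D \<bullet> G \<alpha> x) + D \<bullet> (ys \<nu> t - ys \<nu> s - (t - s) *\<^sub>R G \<alpha> x)"
          by (simp add: inner_diff_right)
        also have "D \<bullet> (ys \<nu> t - ys \<nu> s - (t - s) *\<^sub>R G \<alpha> x) \<le> norm D * ?err"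
          using norm_cauchy_schwarz mult_left_mono[OF inc norm_ge_zero[of D]] by (rule order_trans)
        finally have "h t - h s \<le> (t - s) * (D \<bullet> G \<alpha> x) + norm D * ?err +
            \<eta> * (M * (t - s) + (V \<nu> t - V \<nu> s))"
          using h mult_left_mono[OF lip[OF st] pos(3)] by linarith
        also have "\<dots> = (t - s) * (D \<bullet> G \<alpha> x + norm D * \<epsilon> + \<eta> * M) + (W t - W s)"
          by (simp add: W_def algebra_simps)
        also have "(t - s) * (D \<bullet> G \<alpha> x + norm D * \<epsilon> + \<eta> * M) \<le> (t - s) * (- \<kappa>)"
          using drift st by (intro mult_left_mono) auto
        finally show ?thesis by (simp add: algebra_simps)
      qed
    qed (rule pos)
    also have "\<dots> \<le> ?bound \<nu>"
    proof -
      have "V \<nu> b' - V \<nu> a' \<le> V \<nu> T"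
        using V_mono[of \<nu> b' T] V_nonneg[of \<nu> a'] \<open>\<nu> \<ge> 1\<close> ab ab' by auto
      moreover have "E b' - E a' \<le> measure lebesgue (hits \<nu> (F - B) a b)"
        unfolding E_def using hits_before_le[of "F - B" a b \<nu> b'] hits_before_nonneg[of "F - B" a b \<nu> a'] \<open>\<nu> \<ge> 1\<close> ab by auto
      ultimately have "?L * (V \<nu> b' - V \<nu> a') + 2 * M * norm D * (E b' - E a') \<le>
          ?L * V \<nu> T + 2 * M * norm D * measure lebesgue (hits \<nu> (F - B) a b)"
        using L MD by (intro add_mono mult_left_mono)
      moreover have "W b' - W a' = ?L * (V \<nu> b' - V \<nu> a') + 2 * M * norm D * (E b' - E a')"
        by (simp add: W_def algebra_simps)
      ultimately show ?thesis using pos(1) by (intro mult_left_mono) auto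
    qed
    finally show ?case .
  qed
qed simp

end

text \<open>Only a frontier point needs the chart. If \<open>y \<tau>\<close> is in the open patch,
  \<open>y\<close> stays there for times near \<tau> and the first claim is vacuous; if it is off
  the closure, the approximations eventually stay out and the second claim is vacuous.\<close>

lemma local_behaviour:
  assumes av: "avoids (F - B) a b"
    and \<alpha>: "\<alpha> \<in> B" "\<And>\<beta>. \<beta> \<in> B \<Longrightarrow> (\<beta>, \<alpha>) \<in> r" "B \<subseteq> F"
    and \<tau>: "\<tau> \<in> {a..b}"
  obtains d where "d > 0"
    "\<And>a' b'. a \<le> a' \<Longrightarrow> a' \<le> b' \<Longrightarrow> b' \<le> b \<Longrightarrow> \<tau> - d < a' \<Longrightarrow> b' < \<tau> + d \<Longrightarrow>
       (\<And>u. u \<in> {a'..b'} \<Longrightarrow> y u \<notin> P \<alpha>) \<Longrightarrow> (\<lambda>\<nu>. measure lebesgue (hit \<nu> \<alpha> a' b')) \<longlonglongrightarrow> 0"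
    "\<And>s t. a \<le> s \<Longrightarrow> s \<le> t \<Longrightarrow> t \<le> b \<Longrightarrow> \<tau> - d < s \<Longrightarrow> t < \<tau> + d \<Longrightarrow> y s \<in> P \<alpha> \<Longrightarrow> y t \<in> P \<alpha>"
proof -
  have ab: "0 \<le> a" "b \<le> T" using avoidsD(1,2)[OF av] .
  have \<tau>T: "\<tau> \<in> {0..T}" using \<tau> ab by auto
  have "\<alpha> \<in> A" using \<alpha> F_subset by auto
  note opn = open_patch[OF \<open>\<alpha> \<in> A\<close>]
  consider "y \<tau> \<in> P \<alpha>" | "y \<tau> \<in> frontier (P \<alpha>)" | "y \<tau> \<notin> closure (P \<alpha>)"
    using opn by (auto simp: frontier_def interior_open)
  then show ?thesis
  proof cases
    case 1
    then obtain \<rho> where \<rho>: "\<rho> > 0" "ball (y \<tau>) \<rho> \<subseteq> P \<alpha>"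
      using opn by (auto simp: open_contains_ball)
    obtain d where d: "d > 0" "\<And>s. s \<in> {0..T} \<Longrightarrow> \<bar>s - \<tau>\<bar> < d \<Longrightarrow> y s \<in> ball (y \<tau>) \<rho>"
      using y_near[OF \<tau>T \<rho>(1)] by blast
    have in_P: "y s \<in> P \<alpha>" if "a \<le> s" "s \<le> b" "\<tau> - d < s" "s < \<tau> + d" for s
    proof -
      have "y s \<in> ball (y \<tau>) \<rho>" using that ab by (intro d(2)) (auto simp: abs_if)
      then show ?thesis using \<rho> by blast
    qed
    show ?thesis
    proof (rule that[OF d(1)])
      fix a' b' assume "a \<le> a'" "a' \<le> b'" "b' \<le> b" "\<tau> - d < a'" "b' < \<tau> + d"
        and out: "\<And>u. u \<in> {a'..b'} \<Longrightarrow> y u \<notin> P \<alpha>"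
      then have False using in_P[of a'] out[of a'] by simp
      then show "(\<lambda>\<nu>. measure lebesgue (hit \<nu> \<alpha> a' b')) \<longlonglongrightarrow> 0" ..
    qed (use in_P in auto)
  next
    case 2
    obtain \<kappa> \<epsilon> \<eta> \<rho> \<phi> D where pos: "\<kappa> > 0" "\<epsilon> \<ge> 0" "\<eta> \<ge> 0" "\<rho> > 0"
      and chart: "\<And>z. z \<in> ball (y \<tau>) \<rho> \<Longrightarrow> z \<in> P \<alpha> \<longleftrightarrow> \<phi> z < (0::real)"
      "\<And>p q. p \<in> ball (y \<tau>) \<rho> \<Longrightarrow> q \<in> ball (y \<tau>) \<rho> \<Longrightarrow> \<phi> p - \<phi> q \<le> D \<bullet> (p - q) + \<eta> * norm (p - q)"
      "\<And>z. z \<in> ball (y \<tau>) \<rho> \<Longrightarrow> norm (G \<alpha> z - G \<alpha> (y \<tau>)) \<le> \<epsilon>"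
      "D \<bullet> G \<alpha> (y \<tau>) + norm D * \<epsilon> + \<eta> * M \<le> - \<kappa>"
      by (rule boundary_chart[OF \<open>\<alpha> \<in> A\<close> 2]) (rule that; assumption)
    obtain d where d: "d > 0" "\<And>s. s \<in> {0..T} \<Longrightarrow> \<bar>s - \<tau>\<bar> < d \<Longrightarrow> y s \<in> ball (y \<tau>) (\<rho> / 2)"
      using y_near[OF \<tau>T, of "\<rho> / 2"] pos by auto
    have near: "y s \<in> ball (y \<tau>) (\<rho> / 2)" if "a \<le> s" "s \<le> b" "\<tau> - d < s" "s < \<tau> + d" for s
      using that ab by (intro d(2)) (auto simp: abs_if)
    show ?thesis
    proof (rule that[OF d(1)])
      fix a' b' assume *: "a \<le> a'" "a' \<le> b'" "b' \<le> b" "\<tau> - d < a'" "b' < \<tau> + d"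
        "\<And>u. u \<in> {a'..b'} \<Longrightarrow> y u \<notin> P \<alpha>"
      show "(\<lambda>\<nu>. measure lebesgue (hit \<nu> \<alpha> a' b')) \<longlonglongrightarrow> 0"
        by (rule hitting_time_near_boundary[OF av \<alpha> 2 y_R[OF \<tau>T] pos chart *(1-3) _ *(6)])
           (use * near in auto)
    next
      fix s t assume *: "a \<le> s" "s \<le> t" "t \<le> b" "\<tau> - d < s" "t < \<tau> + d" "y s \<in> P \<alpha>"
      show "y t \<in> P \<alpha>"
      proof (rule no_exit_near_boundary[OF av \<alpha> 2 y_R[OF \<tau>T] pos chart *(1-3) _ *(6)])
        fix u assume "u \<in> {s..t}"
        then have "y u \<in> ball (y \<tau>) (\<rho> / 2)" using * by (intro near) auto
        then show "y u \<in> ball (y \<tau>) \<rho>" using pos by auto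
      qed
    qed
  next
    case 3
    have "open (- closure (P \<alpha>))" by (simp add: open_Compl)
    then obtain \<rho> where "\<rho> > 0" "ball (y \<tau>) \<rho> \<subseteq> - closure (P \<alpha>)"
      using 3 unfolding open_contains_ball by blast
    then have \<rho>: "\<rho> > 0" "ball (y \<tau>) \<rho> \<inter> P \<alpha> = {}" using closure_subset[of "P \<alpha>"] by blast+
    obtain d where d: "d > 0" "\<And>s. s \<in> {0..T} \<Longrightarrow> \<bar>s - \<tau>\<bar> < d \<Longrightarrow> y s \<in> ball (y \<tau>) (\<rho> / 2)"
      using y_near[OF \<tau>T, of "\<rho> / 2"] \<rho> by auto
    have near: "y s \<in> ball (y \<tau>) (\<rho> / 2)" if "a \<le> s" "s \<le> b" "\<tau> - d < s" "s < \<tau> + d" for s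
      using that ab by (intro d(2)) (auto simp: abs_if)
    show ?thesis
    proof (rule that[OF d(1)])
      fix a' b' assume *: "a \<le> a'" "a' \<le> b'" "b' \<le> b" "\<tau> - d < a'" "b' < \<tau> + d"
      have "eventually (\<lambda>\<nu>. \<forall>t\<in>{0..T}. dist (ys \<nu> t) (y t) < \<rho> / 2) sequentially"
        using \<rho> by (intro eventually_close) auto
      then have "eventually (\<lambda>\<nu>. measure lebesgue (hit \<nu> \<alpha> a' b') = 0) sequentially"
      proof eventually_elim
        case (elim \<nu>)
        have "ys \<nu> u \<notin> P \<alpha>" if u: "u \<in> {a'..b'}" for u
        proof -
          have "dist (ys \<nu> u) (y u) < \<rho> / 2" using elim u * ab by auto
          moreover have "dist (y \<tau>) (y u) < \<rho> / 2" using near[of u] u * by auto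
          ultimately have "ys \<nu> u \<in> ball (y \<tau>) \<rho>"
            using dist_triangle_half_r[of "y u" "y \<tau>" \<rho> "ys \<nu> u"] by (simp add: dist_commute)
          then show ?thesis using \<rho> by auto
        qed
        then have "hit \<nu> \<alpha> a' b' = {}" by (auto simp: hit_def)
        then show ?case by simp
      qed
      then show "(\<lambda>\<nu>. measure lebesgue (hit \<nu> \<alpha> a' b')) \<longlonglongrightarrow> 0" by (rule tendsto_eventually)
    next
      fix s t assume *: "a \<le> s" "s \<le> t" "t \<le> b" "\<tau> - d < s" "t < \<tau> + d" "y s \<in> P \<alpha>"
      have "y s \<in> ball (y \<tau>) (\<rho> / 2)" using * by (intro near) auto
      then have "y s \<in> ball (y \<tau>) \<rho>" using \<rho>(1) by auto
      then have False using * \<rho>(2) by blast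
      then show "y t \<in> P \<alpha>" ..
    qed
  qed
qed

section \<open>Gluing short intervals and induction on the remaining patches\<close>

text \<open>A finite exceptional set absorbs entrance times and junctions, is stable under gluing,
  and is null in the end.\<close>

definition piecewise_solution :: "real \<Rightarrow> real \<Rightarrow> bool" where
  "piecewise_solution a b \<longleftrightarrow>
     (\<exists>S. finite S \<and> (\<forall>t\<in>{a<..<b} - S. (y has_vector_derivative g (y t)) (at t)))"

lemma piecewise_solution_combine:
  assumes "piecewise_solution a b" "piecewise_solution b c"
  shows "piecewise_solution a c"
proof -
  obtain S S' where "finite S" "finite S'"
    "\<forall>t\<in>{a<..<b} - S. (y has_vector_derivative g (y t)) (at t)"
    "\<forall>t\<in>{b<..<c} - S'. (y has_vector_derivative g (y t)) (at t)"
    using assms by (auto simp: piecewise_solution_def)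
  then show ?thesis
    unfolding piecewise_solution_def
    by (intro exI[of _ "insert b (S \<union> S')"]) (metis Diff_iff UnCI finite_Un finite_insert greaterThanLessThan_iff insertCI linorder_neqE)
qed

lemma piecewise_solution_in_top_patch:
  assumes av: "avoids (F - B) a b"
    and \<alpha>: "\<alpha> \<in> B" "\<And>\<beta>. \<beta> \<in> B \<Longrightarrow> (\<beta>, \<alpha>) \<in> r" "B \<subseteq> F"
    and inside: "\<And>t. a < t \<Longrightarrow> t < b \<Longrightarrow> y t \<in> P \<alpha>"
  shows "piecewise_solution a b"
proof -
  have "(y has_vector_derivative g (y t)) (at t)" if t: "t \<in> {a<..<b}" for t
  proof -
    have "g (y t) = G \<alpha> (y t)"
      by (rule field_eq_top_patch[OF \<alpha> inside y_R])
         (use t avoidsD[OF av] in \<open>auto simp: avoids_def\<close>)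
    then show ?thesis using derivative_in_top_patch[OF av \<alpha>, of t] inside t by auto
  qed
  then show ?thesis unfolding piecewise_solution_def by (intro exI[of _ "{}"]) auto
qed

lemma piecewise_solution_if_avoids:
  assumes "B \<subseteq> F" "a \<le> b" "avoids (F - B) a b"
  shows "piecewise_solution a b"
proof -
  have "finite B" using assms(1) finite_F finite_subset by blast
  then show ?thesis
    using assms
  proof (induction B arbitrary: a b rule: finite_psubset_induct)
    case (psubset B)
    note av = psubset.prems(3)
    have ab: "0 \<le> a" "b \<le> T" using avoidsD(1,2)[OF av] .
    have "y a \<in> \<Omega>" "norm (y a) \<le> R" using y_in' y_R psubset.prems(2) ab by auto
    then obtain \<beta> where "\<beta> \<in> F" "y a \<in> P \<beta>" using mem_F by (auto simp: \<Omega>_eq)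
    \<comment> \<open>The empty case is contradictory: \<open>y a\<close> lies in some patch of
      \<open>F\<close>, which cannot be a discarded one.\<close>
    then have "B \<noteq> {}" using avoidsD(3)[OF av, of \<beta> a] psubset.prems(2) by auto
    then obtain \<alpha> where \<alpha>: "\<alpha> \<in> B" "\<And>\<beta>. \<beta> \<in> B \<Longrightarrow> (\<beta>, \<alpha>) \<in> r"
      using ex_max_index[OF \<open>finite B\<close>] psubset.prems(1) F_subset by blast
    note \<alpha> = this \<open>B \<subseteq> F\<close>
    have diff: "F - (B - {\<alpha>}) = insert \<alpha> (F - B)" using \<alpha> by auto
    have step: "piecewise_solution a' b'"
      if ab': "a \<le> a'" "a' \<le> b'" "b' \<le> b" and out: "\<And>u. u \<in> {a'..b'} \<Longrightarrow> y u \<notin> P \<alpha>"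
        and lim0: "(\<lambda>\<nu>. measure lebesgue (hit \<nu> \<alpha> a' b')) \<longlonglongrightarrow> 0" for a' b'
    proof (rule psubset.IH[of "B - {\<alpha>}"])
      have "avoids (F - B) a' b'" by (rule avoids_subinterval[OF av _ ab'(1,3)]) auto
      then show "avoids (F - (B - {\<alpha>})) a' b'"
        using out lim0 unfolding diff by (auto simp: avoids_def)
    qed (use \<alpha> ab' in auto)
    \<comment> \<open>Bisection reduces the claim to short intervals containing a given \<tau>, so
      the size \<open>d\<close> may depend on \<tau>.\<close>
    have "a \<le> a \<longrightarrow> b \<le> b \<longrightarrow> piecewise_solution a b"
    proof (rule Bolzano[where P = "\<lambda>s t. a \<le> s \<longrightarrow> t \<le> b \<longrightarrow> piecewise_solution s t"])
      fix \<tau> assume "a \<le> \<tau>" "\<tau> \<le> b"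
      then have \<tau>: "\<tau> \<in> {a..b}" by simp
      obtain d where "d > 0"
        and d: "\<And>a' b'. a \<le> a' \<Longrightarrow> a' \<le> b' \<Longrightarrow> b' \<le> b \<Longrightarrow> \<tau> - d < a' \<Longrightarrow> b' < \<tau> + d \<Longrightarrow>
          (\<And>u. u \<in> {a'..b'} \<Longrightarrow> y u \<notin> P \<alpha>) \<Longrightarrow> (\<lambda>\<nu>. measure lebesgue (hit \<nu> \<alpha> a' b')) \<longlonglongrightarrow> 0"
          "\<And>s t. a \<le> s \<Longrightarrow> s \<le> t \<Longrightarrow> t \<le> b \<Longrightarrow> \<tau> - d < s \<Longrightarrow> t < \<tau> + d \<Longrightarrow> y s \<in> P \<alpha> \<Longrightarrow> y t \<in> P \<alpha>"
        using local_behaviour[OF av \<alpha> \<tau>] by blast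
      have "piecewise_solution a' b'"
        if *: "a' \<le> \<tau>" "\<tau> \<le> b'" "b' - a' < d" "a \<le> a'" "b' \<le> b" for a' b'
      proof -
        have d': "\<tau> - d < a'" "b' < \<tau> + d" using * by auto
        define X where "X = {u\<in>{a'..b'}. y u \<in> P \<alpha>}"
        show ?thesis
        proof (cases "X = {}")
          case True
          then have out: "y u \<notin> P \<alpha>" if "u \<in> {a'..b'}" for u using that by (auto simp: X_def)
          show ?thesis by (rule step[OF _ _ _ out d(1)[OF _ _ _ _ _ out]]) (use * d' in auto)
        next
          case False
          define q where "q = Inf X"
          have "bdd_below X" by (auto simp: X_def)
          obtain u0 where "u0 \<in> X" using False by blast
          have q: "a' \<le> q" "q \<le> b'"
            unfolding q_def using False \<open>u0 \<in> X\<close> \<open>bdd_below X\<close>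
            by (auto simp: X_def intro: cInf_greatest cInf_lower2)
          have before: "y u \<notin> P \<alpha>" if "a' \<le> u" "u < q" for u
            using cInf_lower[OF _ \<open>bdd_below X\<close>, of u] that q by (auto simp: q_def X_def)
          \<comment> \<open>There are points of \<open>X\<close> before \<open>u\<close>, by the
            definition of \<open>q\<close>; from any of them the absence of exits carries membership
            forward to \<open>u\<close>.\<close>
          have after: "y u \<in> P \<alpha>" if "q < u" "u \<le> b'" for u
          proof -
            obtain s where "s \<in> X" "s < u"
              using cInf_lessD[OF False, of u] \<open>q < u\<close> unfolding q_def by blast
            then show ?thesis using d(2)[of s u] that * d' by (auto simp: X_def)
          qed
          have 1: "piecewise_solution a' q"
          proof (cases "a' = q")
            case True
            then show ?thesis by (auto simp: piecewise_solution_def)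
          next
            case neq: False
            \<comment> \<open>Membership at \<open>q\<close> would, by openness, extend to times
              just before \<open>q\<close>. Thus the whole closed interval up to \<open>q\<close>
              avoids the patch, as the induction hypothesis demands.\<close>
            have "y q \<notin> P \<alpha>"
            proof
              assume "y q \<in> P \<alpha>"
              then obtain \<rho> where \<rho>: "\<rho> > 0" "ball (y q) \<rho> \<subseteq> P \<alpha>"
                using open_patch \<alpha> F_subset by (metis open_contains_ball subsetD)
              obtain d where d: "d > 0" "\<And>s. s \<in> {0..T} \<Longrightarrow> \<bar>s - q\<bar> < d \<Longrightarrow> y s \<in> ball (y q) \<rho>"
                using y_near[OF _ \<rho>(1), of q] q * ab by auto
              define s where "s = max a' (q - d / 2)"
              have "a' \<le> s" "s < q" "\<bar>s - q\<bar> < d" using neq q d(1) by (auto simp: s_def)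
              then have "y s \<in> P \<alpha>" using d(2)[of s] \<rho> q * ab by auto
              then show False using before \<open>a' \<le> s\<close> \<open>s < q\<close> by blast
            qed
            then have out: "y u \<notin> P \<alpha>" if "u \<in> {a'..q}" for u
              using before[of u] that by (cases "u = q") auto
            show ?thesis by (rule step[OF _ _ _ out d(1)[OF _ _ _ _ _ out]]) (use * d' q in auto)
          qed
          have 2: "piecewise_solution q b'"
          proof (rule piecewise_solution_in_top_patch[OF _ \<alpha>])
            show "avoids (F - B) q b'"
              by (rule avoids_subinterval[OF av]) (use * q in auto)
          qed (use after in auto)
          show ?thesis using 1 2 by (rule piecewise_solution_combine)
        qed
      qed
      then show "\<exists>d>0. \<forall>a' b'. a' \<le> \<tau> \<and> \<tau> \<le> b' \<and> b' - a' < d \<longrightarrow>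
          a \<le> a' \<longrightarrow> b' \<le> b \<longrightarrow> piecewise_solution a' b'"
        using \<open>d > 0\<close> by blast
    qed (use \<open>a \<le> b\<close> piecewise_solution_combine in auto)
    then show ?case by simp
  qed
qed

lemma absolutely_continuous: "absolutely_continuous_on 0 T y"
  unfolding absolutely_continuous_on_def
proof (intro allI impI)
  fix \<epsilon> :: real assume "\<epsilon> > 0"
  have key: "(\<Sum>i<n. norm (y (u i) - y (l i))) < \<epsilon>"
    if lu: "\<forall>i<n. 0 \<le> l i \<and> l i \<le> u i \<and> u i \<le> T" and small: "(\<Sum>i<n. u i - l i) < \<epsilon> / M"
    for n :: nat and l u :: "nat \<Rightarrow> real"
  proof -
    have "(\<Sum>i<n. norm (y (u i) - y (l i))) \<le> (\<Sum>i<n. M * (u i - l i))"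
    proof (rule sum_mono)
      fix i assume "i \<in> {..<n}"
      then have "0 \<le> l i" "l i \<le> u i" "u i \<le> T" using lu by auto
      then show "norm (y (u i) - y (l i)) \<le> M * (u i - l i)"
        using y_lipschitz[of "l i" "u i"] by auto
    qed
    also have "\<dots> = M * (\<Sum>i<n. u i - l i)" by (simp add: sum_distrib_left)
    also have "\<dots> < \<epsilon>" using small M_pos by (simp add: field_simps)
    finally show ?thesis .
  qed
  have "\<epsilon> / M > 0" using \<open>\<epsilon> > 0\<close> M_pos by simp
  then show "\<exists>\<delta>>0. \<forall>(n::nat) l u. (\<forall>i<n. 0 \<le> l i \<and> l i \<le> u i \<and> u i \<le> T) \<and>
      disjoint_family_on (\<lambda>i. {l i<..<u i}) {..<n} \<and> (\<Sum>i<n. u i - l i) < \<delta> \<longrightarrow>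
      (\<Sum>i<n. norm (y (u i) - y (l i))) < \<epsilon>"
    by (intro exI[of _ "\<epsilon> / M"] conjI allI impI, assumption) (elim conjE, rule key)
qed

lemma caratheodory: "caratheodory_solution g \<Omega> T y"
proof -
  \<comment> \<open>Nothing has been discarded at the start, so the hypothesis is vacuous.\<close>
  have "avoids (F - F) 0 T" by (simp add: avoids_def)
  then obtain S where S: "finite S" "\<And>t. t \<in> {0<..<T} - S \<Longrightarrow> (y has_vector_derivative g (y t)) (at t)"
    using piecewise_solution_if_avoids[of F 0 T] T_pos by (auto simp: piecewise_solution_def)
  have "AE t in lebesgue_on {0..T}. (y has_vector_derivative g (y t)) (at t within {0..T})"
  proof (rule AE_I')
    \<comment> \<open>The double complement intersects the exceptional set with
      \<open>{0..T}\<close>, since null sets of the restricted measure must lie in its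
      space.\<close>
    show "S \<union> {0, T} - - {0..T} \<in> null_sets (lebesgue_on {0..T})"
      using S(1) by (subst null_sets_restrict_space) (auto simp: negligible_iff_null_sets[symmetric] Diff_eq intro: negligible_finite)
    show "{t \<in> space (lebesgue_on {0..T}). \<not> (y has_vector_derivative g (y t)) (at t within {0..T})} \<subseteq> S \<union> {0, T} - - {0..T}"
    proof
      fix t assume t: "t \<in> {t \<in> space (lebesgue_on {0..T}). \<not> (y has_vector_derivative g (y t)) (at t within {0..T})}"
      then have "t \<in> {0..T}" "\<not> (y has_vector_derivative g (y t)) (at t)"
        by (auto intro: has_vector_derivative_at_within)
      then show "t \<in> S \<union> {0, T} - - {0..T}" using S(2)[of t] by (auto simp: less_le)
    qed
  qed
  then show ?thesis
    using absolutely_continuous y_in by (auto simp: caratheodory_solution_def)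
qed

end

lemma (in patchy_limit) limit_is_caratheodory: "caratheodory_solution g \<Omega> T y"
proof -
  obtain R where R: "\<And>t. t \<in> {0..T} \<Longrightarrow> norm (y t) \<le> R"
    "eventually (\<lambda>\<nu>. \<forall>t\<in>{0..T}. norm (ys \<nu> t) \<le> R) sequentially"
    using ex_radius by blast
  obtain M where M: "M > 0"
    "\<And>\<alpha> x. \<alpha> \<in> A \<Longrightarrow> x \<in> closure (P \<alpha>) \<Longrightarrow> norm x \<le> R \<Longrightarrow> norm (G \<alpha> x) \<le> M"
    using ex_field_bound[of R] by blast
  interpret bounded_patchy_limit A r P G \<Omega> g T w ys y R M
    using R M by unfold_locales
  show ?thesis by (rule caratheodory)
qed

theorem theorem1:
  fixes A :: "'i set" and r :: "'i rel"
    and P :: "'i \<Rightarrow> (real ^ 'n) set" and G :: "'i \<Rightarrow> real ^ 'n \<Rightarrow> real ^ 'n"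
    and \<Omega> :: "(real ^ 'n) set" and g :: "real ^ 'n \<Rightarrow> real ^ 'n"
    and T :: real
    and w ys :: "nat \<Rightarrow> real \<Rightarrow> real ^ 'n" and y :: "real \<Rightarrow> real ^ 'n"
  assumes "open \<Omega>"
    and "patchy_vector_field A r P G \<Omega> g"
    and "T > 0"
    and "\<And>\<nu>. \<nu> \<ge> 1 \<Longrightarrow> left_continuous_on 0 T (w \<nu>)"
    and "\<And>\<nu>. \<nu> \<ge> 1 \<Longrightarrow> bounded_variation_on 0 T (w \<nu>)"
    and "(\<lambda>\<nu>. total_variation 0 T (w \<nu>)) \<longlonglongrightarrow> 0"
    and "\<And>\<nu>. \<nu> \<ge> 1 \<Longrightarrow> perturbed_solution g \<Omega> (w \<nu>) T (ys \<nu>)"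
    and "y \<in> {0..T} \<rightarrow> \<Omega>"
    and "uniform_limit {0..T} ys y sequentially"
  shows "caratheodory_solution g \<Omega> T y"
proof -
  interpret patchy_limit A r P G \<Omega> g T w ys y
    using assms(2,3,5-9) by unfold_locales
  show ?thesis by (rule limit_is_caratheodory)
qed

end
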